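(* Graphs of bounded stack-number have bounded expansion; that is, for every constant $k$ the class of all $k$-stack graphs has bounded expansion. In particular, $$\widetilde{\nabla}_r(G)\leq\frac{4k(5k-5)^{2r+1}}{5k-6}$$ for every $k$-stack graph $G$ and every $r\in\mathbb N$.
   Context: All graphs are finite and simple; densities are taken over graphs with at least one vertex. $|G|$ is the number of vertices and $\|G\|$ the number of edges of $G$. $\mathbb N$ includes $0$. Stack layouts: given a linear ordering of $V(G)$, for an edge $e$ let $\ell(e)<r(e)$ be its endpoints. Edges $e,f$ cross if $\ell(e)<\ell(f)<r(e)<r(f)$, or vice versa. A $k$-stack layout of $G$ (also called a $k$-page book embedding) is a linear ordering of $V(G)$ together with a partition of $E(G)$ into $k$ sets (stacks; possibly empty) such that no two edges in the same set cross. A $k$-stack graph is a graph that has a $k$-stack layout; the stack-number of $G$ is the minimum $k$ such that $G$ has a $k$-stack layout. Bounded expansion: for $d\in\mathbb N$, a graph $H$ is a shallow minor of $G$ at depth $d$ if there is a subgraph $X$ of $G$ whose connected components each have radius at most $d$, such that $H$ is a simple graph obtained from $G$ by contracting each component of $X$ into a single vertex and then taking a subgraph. (The radius of a connected graph is the minimum over vertices $r$ of the maximum distance from $r$ to another vertex.) For a class $\mathcal C$, let $\nabla_d(\mathcal C)=\sup \|H\|/|H|$, the supremum over all shallow minors $H$ at depth $d$ of graphs in $\mathcal C$. The class $\mathcal C$ has bounded expansion if there is a function $f:\mathbb N\to\mathbb R$ with $\nabla_d(\mathcal C)\leq f(d)$ for all $d\in\mathbb N$. Topological grad: a $(\leq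 t)$-subdivision of $H$ is a graph obtained from $H$ by replacing each edge $vw$ by a path between $v$ and $w$ with at most $t$ internal (new) vertices. $H$ is a shallow topological minor of $G$ at depth $r$ if some $(\leq 2r)$-subdivision of $H$ is isomorphic to a subgraph of $G$. $\widetilde{\nabla}_r(G)$ is the supremum of $\|H\|/|H|$ over all shallow topological minors $H$ of $G$ at depth $r$.
   Formalization: The numerical bound is stated only for k ≠ 1: for k = 1 its right-hand side is 0, while K_2 is a 1-stack graph whose topological grad is at least 1/2, so the inequality is false there; bounded expansion is stated for every k. *)

theory Defs
  imports Complex_Main "HOL-Library.Extended_Real" "HOL-Library.Disjoint_Sets"
begin

record 'a graph =
  verts :: "'a set"
  edges :: "'a set set"

definition simple_graph :: "'a graph \<Rightarrow> bool" where
  "simple_graph G \<longleftrightarrow> finite (verts G) \<and> (\<forall>e\<in>edges G. e \<subseteq> verts G \<and> card e = 2)"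

definition subgraph :: "'a graph \<Rightarrow> 'a graph \<Rightarrow> bool" where
  "subgraph H G \<longleftrightarrow> simple_graph H \<and> verts H \<subseteq> verts G \<and> edges H \<subseteq> edges G"

definition induced_subgraph :: "'a graph \<Rightarrow> 'a set \<Rightarrow> 'a graph" where
  "induced_subgraph G U = \<lparr>verts = verts G \<inter> U, edges = {e \<in> edges G. e \<subseteq> U}\<rparr>"

definition isomorphic :: "'a graph \<Rightarrow> 'b graph \<Rightarrow> bool" where
  "isomorphic G H \<longleftrightarrow>
     (\<exists>\<phi>. bij_betw \<phi> (verts G) (verts H) \<and> edges H = (\<lambda>e. \<phi> ` e) ` edges G)"

definition density :: "'a graph \<Rightarrow> real" where
  "density G = real (card (edges G)) / real (card (verts G))"


subsection \<open>Stack layouts\<close>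

definition left_end :: "'a rel \<Rightarrow> 'a set \<Rightarrow> 'a" where
  "left_end R e = (THE x. x \<in> e \<and> (\<forall>y\<in>e. (x, y) \<in> R))"

definition right_end :: "'a rel \<Rightarrow> 'a set \<Rightarrow> 'a" where
  "right_end R e = (THE x. x \<in> e \<and> (\<forall>y\<in>e. (y, x) \<in> R))"

text \<open>Linear orders are reflexive relations, so \<open>R - Id\<close> is the strict order.\<close>

definition crosses :: "'a rel \<Rightarrow> 'a set \<Rightarrow> 'a set \<Rightarrow> bool" where
  "crosses R e f \<longleftrightarrow>
     (left_end R e, left_end R f) \<in> R - Id \<and>
     (left_end R f, right_end R e) \<in> R - Id \<and>
     (right_end R e, right_end R f) \<in> R - Id"

definition stack_layout :: "nat \<Rightarrow> 'a graph \<Rightarrow> 'a rel \<Rightarrow> (nat \<Rightarrow> 'a set set) \<Rightarrow> bool" where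
  "stack_layout k G R P \<longleftrightarrow>
     linear_order_on (verts G) R \<and>
     (\<Union>i<k. P i) = edges G \<and> disjoint_family_on P {..<k} \<and>
     (\<forall>i<k. \<forall>e\<in>P i. \<forall>f\<in>P i. \<not> crosses R e f \<and> \<not> crosses R f e)"

definition stack_graph :: "nat \<Rightarrow> 'a graph \<Rightarrow> bool" where
  "stack_graph k G \<longleftrightarrow> simple_graph G \<and> (\<exists>R P. stack_layout k G R P)"


subsection \<open>Distance, components and radius\<close>

definition path_edges :: "'a list \<Rightarrow> 'a set set" where
  "path_edges p = {{p ! i, p ! Suc i} | i. Suc i < length p}"

definition walk_between :: "'a graph \<Rightarrow> 'a \<Rightarrow> 'a list \<Rightarrow> 'a \<Rightarrow> bool" where
  "walk_between G u p v \<longleftrightarrow>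
     p \<noteq> [] \<and> hd p = u \<and> last p = v \<and> set p \<subseteq> verts G \<and> path_edges p \<subseteq> edges G"

definition graph_dist :: "'a graph \<Rightarrow> 'a \<Rightarrow> 'a \<Rightarrow> nat" where
  "graph_dist G u v = (LEAST n. \<exists>p. walk_between G u p v \<and> length p = Suc n)"

definition component_sets :: "'a graph \<Rightarrow> 'a set set" where
  "component_sets G = {{v. \<exists>p. walk_between G u p v} | u. u \<in> verts G}"

definition components :: "'a graph \<Rightarrow> 'a graph set" where
  "components G = induced_subgraph G ` component_sets G"

text \<open>Only meaningful for connected graphs with at least one vertex.\<close>

definition radius :: "'a graph \<Rightarrow> nat" where
  "radius G = (MIN r\<in>verts G. MAX v\<in>verts G. graph_dist G r v)"


subsection \<open>Shallow minors and bounded expansion\<close>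

text \<open>
  Each component of \<open>X\<close> becomes a vertex, represented by its vertex set; a vertex of \<open>G\<close>
  outside \<open>X\<close> is left alone and is represented by a singleton. Loops and parallel edges
  arising from the contraction are discarded.
\<close>

definition contract :: "'a graph \<Rightarrow> 'a graph \<Rightarrow> 'a set graph" where
  "contract G X =
     (let W = component_sets X \<union> {{v} | v. v \<in> verts G - verts X}
      in \<lparr>verts = W,
          edges = {{A, B} | A B. A \<in> W \<and> B \<in> W \<and> A \<noteq> B \<and>
                     (\<exists>a\<in>A. \<exists>b\<in>B. {a, b} \<in> edges G)}\<rparr>)"

definition shallow_minor :: "nat \<Rightarrow> 'a set graph \<Rightarrow> 'a graph \<Rightarrow> bool" where
  "shallow_minor d H G \<longleftrightarrow>
     (\<exists>X. subgraph X G \<and> (\<forall>C\<in>components X. radius C \<le> d) \<and> subgraph H (contract G X))"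

definition grad :: "nat \<Rightarrow> 'a graph set \<Rightarrow> ereal" where
  "grad d \<C> =
     (SUP H\<in>{H. verts H \<noteq> {} \<and> (\<exists>G\<in>\<C>. shallow_minor d H G)}. ereal (density H))"

definition bounded_expansion :: "'a graph set \<Rightarrow> bool" where
  "bounded_expansion \<C> \<longleftrightarrow> (\<exists>f :: nat \<Rightarrow> real. \<forall>d. grad d \<C> \<le> ereal (f d))"


subsection \<open>Shallow topological minors\<close>

definition internal_verts :: "'a list \<Rightarrow> 'a set" where
  "internal_verts p = set (butlast (tl p))"

text \<open>
  \<open>P e\<close> is the path replacing the edge \<open>e\<close>. It is given by its list of vertices, including
  both ends, so at most \<open>t\<close> internal vertices means length at most \<open>t + 2\<close>.
\<close>

definition subdivision :: "nat \<Rightarrow> 'a graph \<Rightarrow> 'a graph \<Rightarrow> bool" where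
  "subdivision t H S \<longleftrightarrow>
     (\<exists>P. (\<forall>e\<in>edges H. P e \<noteq> [] \<and> distinct (P e) \<and> {hd (P e), last (P e)} = e \<and>
             length (P e) \<le> t + 2 \<and> internal_verts (P e) \<inter> verts H = {}) \<and>
          disjoint_family_on (\<lambda>e. internal_verts (P e)) (edges H) \<and>
          S = \<lparr>verts = verts H \<union> (\<Union>e\<in>edges H. internal_verts (P e)),
               edges = (\<Union>e\<in>edges H. path_edges (P e))\<rparr>)"

text \<open>
  Taking \<open>H\<close> and its subdivision over the vertex type of \<open>G\<close> loses no generality, even if
  that type is finite: a subdivision that embeds into \<open>G\<close> has a copy inside \<open>G\<close>, whose
  branch vertices carry a copy of \<open>H\<close>.
\<close>

definition shallow_topological_minor :: "nat \<Rightarrow> 'a graph \<Rightarrow> 'a graph \<Rightarrow> bool" where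
  "shallow_topological_minor r H G \<longleftrightarrow>
     simple_graph H \<and>
     (\<exists>S S'. subdivision (2 * r) H S \<and> subgraph S' G \<and> isomorphic S S')"

definition topological_grad :: "nat \<Rightarrow> 'a graph \<Rightarrow> ereal" where
  "topological_grad r G =
     (SUP H\<in>{H. verts H \<noteq> {} \<and> shallow_topological_minor r H G}. ereal (density H))"

end

theory Submission imports Defs begin

text \<open>
  Put the vertices on a spine, at integer positions.  The edges of one page do not cross, and this
  survives contracting stretches of the spine: if the spine is cut into \<open>B\<close> segments, the edges of
  one page join at most \<open>4 B\<close> ordered pairs of distinct segments, because an outerplanar graph on
  \<open>B\<close> vertices has fewer than \<open>2 B\<close> edges (\<open>card_noncrossing_relation\<close>).

  Let \<open>H\<close> be a graph on \<open>n\<close> vertices, each edge of which is realised by a path in the given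
  \<open>k\<close>-stack graph.  Consider only those paths that use one given sequence of pages, and follow them
  from their first vertices outwards.  The invariant is that the spine can be cut into \<open>4 ^ j * n\<close>
  segments so that the paths whose \<open>j\<close>-th point lies in a fixed segment have at most \<open>2 ^ j\<close>
  different first vertices.  For the step to \<open>j + 1\<close>, look at the \<open>(j + 1)\<close>-st points in a
  segment \<open>T\<close>.  By planarity, those whose predecessor is in another segment \<open>S\<close> are not
  interlaced with those coming from a third segment, so cutting \<open>T\<close> once per neighbouring segment
  leaves pieces that receive points from a single \<open>S\<close> and from \<open>T\<close> itself.  That doubles the
  number of first vertices seen, and the outerplanar bound shows that the number of segments grows by
  a factor of at most 4 (\<open>refine_cuts\<close>).  Points coming from \<open>T\<close> itself can be interlaced with the
  others arbitrarily often, and this is why the invariant allows several first vertices per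
  segment instead of one.

  Following the paths from both ends until they meet in a middle edge (\<open>card_linked_le\<close>), every
  ordered pair of segments accounts for at most \<open>2 ^ f * 2 ^ g\<close> paths, because \<open>H\<close> is simple and
  a path is thus known from its two ends.  So the number of paths with a given page sequence
  is linear in \<open>n\<close>, and there are boundedly many page sequences.

  For subdivisions, successive edges on the same page are first merged into one arc; the merged
  arcs still do not cross, by a parity argument (\<open>crossing_walks\<close>).  Then only the
  \<open>k * (k - 1) ^ i\<close> page sequences without repetitions matter for paths with \<open>i\<close> turning points,
  each of them has at most \<open>8 * 5 ^ i * n\<close> paths, and every edge is counted twice, once per
  direction.  The sum over \<open>i\<close> is geometric and gives the stated constant.

  For shallow minors, each branch set contains a breadth-first search tree of depth at most \<open>d\<close>, and an
  edge of \<open>H\<close> is realised by the path between two roots through an edge joining the two branch sets.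
  Such paths may share vertices near a root, which is harmless: what the
  invariant needs is that a point determines its predecessor.
\<close>

section \<open>Noncrossing relations on the spine\<close>

text \<open>
  The arguments \<open>a b\<close> and \<open>c d\<close> are the end points of two edges, each pair in either order; the
  edge \<open>a b\<close> is the one that starts further left.
\<close>
definition crossing :: "nat \<Rightarrow> nat \<Rightarrow> nat \<Rightarrow> nat \<Rightarrow> bool" where
  "crossing a b c d \<longleftrightarrow> min a b < min c d \<and> min c d < max a b \<and> max a b < max c d"

lemma crossing_commute: "crossing b a c d = crossing a b c d" "crossing a b d c = crossing a b c d"
  by (simp_all add: crossing_def min.commute max.commute)

text \<open>
  Every pair \<open>(a, b)\<close> is the longest one that starts in \<open>a\<close> or the longest one that ends in \<open>b\<close>,
  for otherwise a longer pair starting in \<open>a\<close> would cross a longer pair ending in \<open>b\<close>.  So each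
  point is charged at most twice.
\<close>
lemma card_noncrossing_pairs:
  fixes E :: "(nat \<times> nat) set"
  assumes fin: "finite E" and lt: "\<And>a b. (a, b) \<in> E \<Longrightarrow> a < b"
    and nc: "\<And>a b c d. (a, b) \<in> E \<Longrightarrow> (c, d) \<in> E \<Longrightarrow> \<not> crossing a b c d"
  shows "card E \<le> 2 * card (Field E)"
proof -
  define E1 where "E1 = {(a, b) \<in> E. \<forall>b'. (a, b') \<in> E \<longrightarrow> b' \<le> b}"
  define E2 where "E2 = {(a, b) \<in> E. \<forall>a'. (a', b) \<in> E \<longrightarrow> a \<le> a'}"
  have sub: "E \<subseteq> E1 \<union> E2"
  proof (clarify, rule ccontr)
    fix a b assume ab: "(a, b) \<in> E" "(a, b) \<notin> E2" and "(a, b) \<notin> E1"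
    then obtain a' b' where "(a, b') \<in> E" "b < b'" "(a', b) \<in> E" "a' < a"
      by (auto simp: E1_def E2_def not_le)
    moreover have "a < b" using lt ab by blast
    ultimately show False using nc[of a' b a b'] by (auto simp: crossing_def)
  qed
  have fF: "finite (Field E)" using fin by (rule finite_Field)
  have "card E1 \<le> card (Field E)"
  proof (rule card_inj_on_le[OF _ _ fF])
    show "inj_on fst E1" unfolding inj_on_def E1_def by (auto intro: antisym)
    show "fst ` E1 \<subseteq> Field E" unfolding E1_def Field_def by auto
  qed
  moreover have "card E2 \<le> card (Field E)"
  proof (rule card_inj_on_le[OF _ _ fF])
    show "inj_on snd E2" unfolding inj_on_def E2_def by (auto intro: antisym)
    show "snd ` E2 \<subseteq> Field E" unfolding E2_def Field_def by auto
  qed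
  moreover have "card E \<le> card E1 + card E2"
  proof -
    have "finite (E1 \<union> E2)" by (rule finite_subset[OF _ fin]) (auto simp: E1_def E2_def)
    then have "card E \<le> card (E1 \<union> E2)" using sub by (rule card_mono)
    then show ?thesis using card_Un_le[of E1 E2] by linarith
  qed
  ultimately show ?thesis by linarith
qed

lemma card_noncrossing_relation:
  fixes A :: "(nat \<times> nat) set"
  assumes fin: "finite A" and irr: "\<And>a. (a, a) \<notin> A"
    and nc: "\<And>a b c d. (a, b) \<in> A \<Longrightarrow> (c, d) \<in> A \<Longrightarrow> \<not> crossing a b c d"
  shows "card A \<le> 4 * card (Field A)"
proof -
  let ?up = "{(a, b) \<in> A. a < b}" and ?dn = "{(a, b). (b, a) \<in> A \<and> a < b}"
  have fdn: "finite ?dn" by (rule finite_subset[of _ "A\<inverse>"]) (auto simp: fin)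
  have fup: "finite ?up" by (rule finite_subset[OF _ fin]) auto
  have ff: "finite (Field A)" using fin by (rule finite_Field)
  have sub: "A \<subseteq> ?up \<union> ?dn\<inverse>" using irr by (auto simp: not_less le_less)
  have "card A \<le> card ?up + card ?dn"
  proof -
    have "card A \<le> card (?up \<union> ?dn\<inverse>)" using sub fup fdn by (intro card_mono) auto
    then show ?thesis using card_Un_le[of ?up "?dn\<inverse>"] by (simp add: card_inverse)
  qed
  moreover have "card ?up \<le> 2 * card (Field ?up)"
    by (rule card_noncrossing_pairs[OF fup]) (use nc in auto)
  moreover have "card ?dn \<le> 2 * card (Field ?dn)"
  proof (rule card_noncrossing_pairs[OF fdn])
    fix a b c d assume "(a, b) \<in> ?dn" "(c, d) \<in> ?dn"
    then show "\<not> crossing a b c d" using nc[of b a d c] by (auto simp: crossing_def min_def max_def)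
  qed auto
  moreover have "card (Field ?up) \<le> card (Field A)" "card (Field ?dn) \<le> card (Field A)"
    using ff by (auto intro!: card_mono simp: Field_def)
  ultimately show ?thesis by linarith
qed

section \<open>Cutting the spine into segments\<close>

text \<open>
  A finite set \<open>K\<close> of cuts divides the spine into \<open>card K + 1\<close> segments, a cut belonging to the segment on
  its right; \<open>seg K a\<close> is the number, counted from the left, of the segment that contains \<open>a\<close>.
\<close>
definition seg :: "nat set \<Rightarrow> nat \<Rightarrow> nat" where
  "seg K a = card {c \<in> K. c \<le> a}"

lemma seg_mono: "finite K \<Longrightarrow> a \<le> b \<Longrightarrow> seg K a \<le> seg K b"
  unfolding seg_def by (rule card_mono) auto

lemma seg_less: "finite K \<Longrightarrow> seg K a < seg K b \<Longrightarrow> a < b"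
  using seg_mono[of K b a] by linarith

lemma seg_le_card: "finite K \<Longrightarrow> seg K a \<le> card K"
  unfolding seg_def by (rule card_mono) auto

lemma seg_eqD:
  assumes "finite K" "seg K a = seg K b" "c \<in> K"
  shows "c \<le> a \<longleftrightarrow> c \<le> b"
proof -
  have *: "{c \<in> K. c \<le> a} = {c \<in> K. c \<le> b}" if "a \<le> b" "seg K a = seg K b" for a b
    using that assms(1) by (intro card_subset_eq) (auto simp: seg_def)
  have "{c \<in> K. c \<le> a} = {c \<in> K. c \<le> b}"
    using *[of a b] *[of b a] assms(2) by (metis nat_le_linear)
  then show ?thesis using assms(3) by blast
qed

lemma seg_eq_subset:
  assumes "finite K'" "K \<subseteq> K'" "seg K' a = seg K' b"
  shows "seg K a = seg K b"
proof -
  have "{c \<in> K. c \<le> a} = {c \<in> K. c \<le> b}" using seg_eqD[OF assms(1,3)] assms(2) by blast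
  then show ?thesis by (simp add: seg_def)
qed

text \<open>
  Contracting segments is monotone, so it creates no crossings.
\<close>
lemma crossing_seg:
  assumes "finite K" "crossing (seg K a) (seg K b) (seg K c) (seg K d)"
  shows "crossing a b c d"
proof -
  have m: "mono (seg K)" using seg_mono[OF assms(1)] by (simp add: mono_def)
  have "min (seg K a) (seg K b) = seg K (min a b)" "min (seg K c) (seg K d) = seg K (min c d)"
     "max (seg K a) (seg K b) = seg K (max a b)" "max (seg K c) (seg K d) = seg K (max c d)"
    using m by (auto simp: min_of_mono max_of_mono)
  then show ?thesis using assms(2) seg_less[OF assms(1)] unfolding crossing_def by metis
qed

text \<open>
  The planarity fact behind the refinement of cuts.  Read \<open>p1 < p2 < p3\<close> as points of a segment \<open>T\<close>
  with partners \<open>s1\<close>, \<open>s2\<close>, \<open>s3\<close> outside \<open>T\<close>, where \<open>s1\<close> and \<open>s3\<close> lie in one segment and \<open>s2\<close>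
  lies in another one.  On the same side of \<open>T\<close>, noncrossing edges are nested, which would put
  \<open>s2\<close> between \<open>s1\<close> and \<open>s3\<close>; on the other side, the edge at \<open>p2\<close> crosses one of the outer two.
\<close>
lemma interlaced_bundles_False:
  assumes p: "p1 < p2" "p2 < p3"
    and s: "s1 < p1 \<and> s3 < p1 \<or> p3 < s1 \<and> p3 < s3" "s2 < p1 \<or> p3 < s2"
    and side: "s1 < s2 \<longleftrightarrow> s3 < s2" "s1 \<noteq> s2" "s3 \<noteq> s2"
    and nc: "\<not> crossing s1 p1 s2 p2" "\<not> crossing s2 p2 s1 p1"
      "\<not> crossing s3 p3 s2 p2" "\<not> crossing s2 p2 s3 p3"
  shows False
proof -
  have mm: "min a b = a" "max a b = b" "min b a = a" "max b a = b" if "a < b" for a b :: nat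
    using that by simp_all
  consider "s1 < p1" "s3 < p1" "s2 < p1" | "s1 < p1" "s3 < p1" "p3 < s2"
    | "p3 < s1" "p3 < s3" "s2 < p1" | "p3 < s1" "p3 < s3" "p3 < s2"
    using s by blast
  then show False
  proof cases
    case 1
    then have "s1 < p1" "s2 < p2" "s3 < p3" using p by simp_all
    then show ?thesis using 1 p side nc unfolding crossing_def by (simp only: mm) linarith
  next
    case 2
    then have "s1 < p1" "p2 < s2" "s3 < p3" using p by simp_all
    then show ?thesis using 2 p side nc unfolding crossing_def by (simp only: mm) linarith
  next
    case 3
    then have "p1 < s1" "s2 < p2" "p3 < s3" using p by simp_all
    then show ?thesis using 3 p side nc unfolding crossing_def by (simp only: mm) linarith
  next
    case 4
    then have "p1 < s1" "p2 < s2" "p3 < s3" using p by simp_all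
    then show ?thesis using 4 p side nc unfolding crossing_def by (simp only: mm) linarith
  qed
qed

text \<open>
  One step outwards along all paths.  In a segment \<open>T\<close>, one cut is made at the first point that is
  reached from \<open>S\<close>, for each segment \<open>S \<noteq> T\<close> from which points of \<open>T\<close> are reached, except for
  the leftmost of these cuts.  The exception is what makes the factor 4: the segments \<open>T\<close>
  that have neighbours get at most their degree minus one cuts, and the degrees add up to at most 4
  per such segment.
\<close>
lemma refine_cuts:
  fixes x y :: "'e \<Rightarrow> nat" and lab :: "'e \<Rightarrow> 'l"
  assumes finF: "finite F" and finK: "finite K"
    and par: "\<And>e e'. e \<in> F \<Longrightarrow> e' \<in> F \<Longrightarrow> y e = y e' \<Longrightarrow> x e = x e'"
    and nc: "\<And>e e'. e \<in> F \<Longrightarrow> e' \<in> F \<Longrightarrow> \<not> crossing (x e) (y e) (x e') (y e')"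
    and lab: "\<And>s. card (lab ` {e \<in> F. seg K (x e) = s}) \<le> C"
  shows "\<exists>K'. finite K' \<and> K \<subseteq> K' \<and> card K' + 1 \<le> 4 * (card K + 1) \<and>
           (\<forall>s. card (lab ` {e \<in> F. seg K' (y e) = s}) \<le> 2 * C)"
proof -
  let ?S = "\<lambda>e. seg K (x e)" and ?T = "\<lambda>e. seg K (y e)"
  \<comment> \<open>\<open>D `` {T}\<close> are the segments from which \<open>T\<close> is reached, \<open>A\<close> is the symmetric closure of \<open>D\<close>.\<close>
  define D where "D = {(?T e, ?S e) |e. e \<in> F \<and> ?S e \<noteq> ?T e}"
  define A where "A = D \<union> D\<inverse>"
  define c where "c T S = Min {y e |e. e \<in> F \<and> ?S e = S \<and> ?T e = T}" for T S
  define cuts where "cuts T = c T ` (D `` {T}) - {Min (c T ` (D `` {T}))}" for T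
  define K' where "K' = K \<union> (\<Union>T\<in>Field A. cuts T)"
  have finD: "finite D" unfolding D_def using finF by simp
  have finA: "finite A" using finD by (simp add: A_def)
  have finFA: "finite (Field A)" using finA by (rule finite_Field)
  have fincut: "finite (cuts T)" for T using finD by (simp add: cuts_def)
  have finK': "finite K'" using finK finFA fincut by (simp add: K'_def)
  have irr: "(a, a) \<notin> A" for a by (auto simp: A_def D_def)
  have ncS: "\<not> crossing (?S e) (?T e) (?S e') (?T e')" if "e \<in> F" "e' \<in> F" for e e'
    using crossing_seg[OF finK] nc that by blast
  have cardA: "card A \<le> 4 * card (Field A)"
  proof (rule card_noncrossing_relation[OF finA irr])
    fix a b c d assume "(a, b) \<in> A" "(c, d) \<in> A"
    then show "\<not> crossing a b c d"
      using ncS crossing_commute unfolding A_def D_def by blast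
  qed
  have "card (cuts T) + 1 \<le> card (A `` {T})" if "T \<in> Field A" for T
  proof -
    have ne: "A `` {T} \<noteq> {}" using that by (auto simp: A_def Field_def)
    have finAT: "finite (A `` {T})" using finA by simp
    show ?thesis
    proof (cases "D `` {T} = {}")
      case True
      then have "cuts T = {}" by (simp add: cuts_def)
      then show ?thesis using ne finAT by (simp add: Suc_le_eq card_gt_0_iff)
    next
      case False
      have fD: "finite (D `` {T})" using finD by simp
      have "card (cuts T) = card (c T ` (D `` {T})) - 1"
        unfolding cuts_def using False fD by (subst card_Diff_singleton) auto
      moreover have "card (c T ` (D `` {T})) \<le> card (D `` {T})" using fD by (rule card_image_le)
      moreover have "card (D `` {T}) \<le> card (A `` {T})"
        using finAT by (rule card_mono) (auto simp: A_def)
      moreover have "card (c T ` (D `` {T})) > 0" using False fD by (simp add: card_gt_0_iff)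
      ultimately show ?thesis by linarith
    qed
  qed
  then have "(\<Sum>T\<in>Field A. card (cuts T) + 1) \<le> (\<Sum>T\<in>Field A. card (A `` {T}))" by (rule sum_mono)
  also have "\<dots> = card (Sigma (Field A) (\<lambda>T. A `` {T}))" using finFA finA by (simp add: card_SigmaI)
  also have "Sigma (Field A) (\<lambda>T. A `` {T}) = A" by (auto simp: Field_def)
  finally have "(\<Sum>T\<in>Field A. card (cuts T)) \<le> 3 * card (Field A)"
    using cardA by (simp add: sum.distrib sum_Suc)
  moreover have "card (Field A) \<le> card K + 1"
  proof -
    have "Field A \<subseteq> {..card K}" using seg_le_card[OF finK] by (auto simp: A_def D_def Field_def)
    from card_mono[OF _ this] show ?thesis by simp
  qed
  moreover have "card K' \<le> card K + (\<Sum>T\<in>Field A. card (cuts T))"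
    using card_Un_le[of K "\<Union>T\<in>Field A. cuts T"] card_UN_le[OF finFA, of cuts]
    unfolding K'_def by linarith
  moreover have "m + 1 \<le> 4 * (n + 1)" if "a \<le> 3 * b" "b \<le> n + 1" "m \<le> n + a" for a b m n :: nat
    using that by presburger
  ultimately have cardK': "card K' + 1 \<le> 4 * (card K + 1)" by blast
  have c_in: "\<exists>e1. e1 \<in> F \<and> ?S e1 = ?S e \<and> ?T e1 = ?T e \<and> c (?T e) (?S e) = y e1 \<and> y e1 \<le> y e"
    if "e \<in> F" for e
  proof -
    let ?Y = "{y e' |e'. e' \<in> F \<and> ?S e' = ?S e \<and> ?T e' = ?T e}"
    have f: "finite ?Y" using finF by simp
    have "y e \<in> ?Y" using that by blast
    then have "Min ?Y \<in> ?Y" "Min ?Y \<le> y e" using f Min_in[of ?Y] Min_le[of ?Y] by blast+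
    then show ?thesis unfolding c_def by auto
  qed
  \<comment> \<open>If two bundles met in one new piece, the later bundle would start at a cut inside the earlier one.\<close>
  have aux: False
    if h: "e \<in> F" "e' \<in> F" "?S e \<noteq> ?T e" "?S e' \<noteq> ?T e'" "seg K' (y e) = seg K' (y e')" "?S e \<noteq> ?S e'"
      "c (?T e) (?S e) \<le> c (?T e') (?S e')" for e e'
  proof -
    have TT: "?T e = ?T e'" using seg_eq_subset[OF finK' _ h(5)] by (auto simp: K'_def)
    obtain e1 where e1: "e1 \<in> F" "?S e1 = ?S e" "?T e1 = ?T e" "c (?T e) (?S e) = y e1"
      using c_in[OF h(1)] by blast
    obtain e2 where e2: "e2 \<in> F" "?S e2 = ?S e'" "?T e2 = ?T e'" "c (?T e') (?S e') = y e2" "y e2 \<le> y e'"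
      using c_in[OF h(2)] by blast
    have neq: "y e1 \<noteq> y e2" "y e \<noteq> y e2"
      using par e1(1,2) e2(1,2) h(1,6) by metis+
    have lt: "y e1 < y e2" using h(7) e1 e2 neq by simp
    have inD: "?S e \<in> D `` {?T e}" "?S e' \<in> D `` {?T e}"
      
    proof -
      have "(?T e, ?S e) \<in> D" "(?T e', ?S e') \<in> D" using h(1-4) unfolding D_def by blast+
      then show "?S e \<in> D `` {?T e}" "?S e' \<in> D `` {?T e}" using TT by auto
    qed
    have "Min (c (?T e) ` (D `` {?T e})) \<le> y e1"
      using inD(1) e1(4) finD by (intro Min_le finite_imageI finite_Image) (metis image_eqI)+
    then have "y e2 \<in> cuts (?T e)" 
      using lt inD(2) e2(4) TT unfolding cuts_def by (metis DiffI image_eqI leD singletonD)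
    moreover have "?T e \<in> Field A" using inD by (auto simp: A_def Field_def)
    ultimately have "y e2 \<in> K'" by (auto simp: K'_def)
    then have "y e2 \<le> y e" using seg_eqD[OF finK' h(5)] e2(5) by blast
    then have lt2: "y e2 < y e" using neq by simp
    have n1: "\<not> crossing (x e1) (y e1) (x e2) (y e2)" "\<not> crossing (x e2) (y e2) (x e1) (y e1)"
      "\<not> crossing (x e) (y e) (x e2) (y e2)" "\<not> crossing (x e2) (y e2) (x e) (y e)"
      using nc e1 e2 h by blast+
    have mm: "a < b" if "seg K a < seg K b" for a b using seg_less[OF finK that] .
    have sq: "?S e1 = ?S e" "?S e2 \<noteq> ?S e" "?T e1 = ?T e" "?T e2 = ?T e" "?S e \<noteq> ?T e" "?S e2 \<noteq> ?T e"
      using e1 e2 TT h by auto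
    have q: "x e1 < x e2 \<longleftrightarrow> x e < x e2"
      using sq mm[of "x e1" "x e2"] mm[of "x e" "x e2"] mm[of "x e2" "x e1"] mm[of "x e2" "x e"]
      by (metis linorder_neqE_nat not_less_iff_gr_or_eq)
    have t1: "?S e < ?T e \<longleftrightarrow> x e1 < y e1" "?S e < ?T e \<longleftrightarrow> x e < y e1" "?S e < ?T e \<longleftrightarrow> x e < y e"
       "?S e < ?T e \<longleftrightarrow> x e1 < y e" "x e1 \<noteq> y e1" "x e \<noteq> y e1" "x e1 \<noteq> y e" "x e \<noteq> y e"
       "?S e2 < ?T e \<longleftrightarrow> x e2 < y e1" "?S e2 < ?T e \<longleftrightarrow> x e2 < y e" "x e2 \<noteq> y e1" "x e2 \<noteq> y e"
      using sq mm linorder_neqE_nat less_asym by metis+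
    have s2: "x e1 \<noteq> x e2" "x e \<noteq> x e2" using sq by metis+
    have "x e1 < y e1 \<and> x e < y e1 \<or> y e < x e1 \<and> y e < x e" "x e2 < y e1 \<or> y e < x e2"
      using t1 by (meson linorder_neqE_nat)+
    then show False using interlaced_bundles_False[OF lt lt2 _ _ q s2] n1 by blast
  qed
  have one: "?S e = ?S e'"
    if "e \<in> F" "e' \<in> F" "?S e \<noteq> ?T e" "?S e' \<noteq> ?T e'" "seg K' (y e) = seg K' (y e')" for e e'
    using aux[of e e'] aux[of e' e] that by (metis linear)
  have "card (lab ` {e \<in> F. seg K' (y e) = s}) \<le> 2 * C" for s
  proof (cases "\<exists>e0\<in>F. seg K' (y e0) = s")
    case False
    then have "{e \<in> F. seg K' (y e) = s} = {}" by auto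
    then show ?thesis by (metis card.empty image_empty le0)
  next
    case True
    then obtain e0 where e0: "e0 \<in> F" "seg K' (y e0) = s" by blast
    have T0: "?T e = ?T e0" if "seg K' (y e) = s" for e
      using seg_eq_subset[OF finK', of K "y e" "y e0"] that e0 by (auto simp: K'_def)
    obtain S0 where S0: "\<And>e. e \<in> F \<Longrightarrow> seg K' (y e) = s \<Longrightarrow> ?S e \<noteq> ?T e \<Longrightarrow> ?S e = S0"
      using one by metis
    \<comment> \<open>Labels in a new piece come from the old segment around it or from the single other segment \<open>S0\<close>.\<close>
    let ?L = "\<lambda>s. lab ` {e \<in> F. seg K (x e) = s}"
    have "lab ` {e \<in> F. seg K' (y e) = s} \<subseteq> ?L (?T e0) \<union> ?L S0"
    proof
      fix l assume "l \<in> lab ` {e \<in> F. seg K' (y e) = s}"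
      then obtain e where e: "e \<in> F" "seg K' (y e) = s" "l = lab e" by blast
      show "l \<in> ?L (?T e0) \<union> ?L S0"
        using S0[OF e(1,2)] T0[OF e(2)] e(1,3) by (cases "?S e = ?T e") auto
    qed
    then have "card (lab ` {e \<in> F. seg K' (y e) = s}) \<le> card (?L (?T e0) \<union> ?L S0)"
      using finF by (intro card_mono) auto
    also have "\<dots> \<le> card (?L (?T e0)) + card (?L S0)" by (rule card_Un_le)
    also have "\<dots> \<le> 2 * C" using lab[of "?T e0"] lab[of S0] by linarith
    finally show ?thesis .
  qed
  then show ?thesis using finK' cardK' by (auto simp: K'_def)
qed

lemma iterate_cuts:
  fixes x :: "nat \<Rightarrow> 'e \<Rightarrow> nat" and lab :: "'e \<Rightarrow> 'l"
  assumes finF: "finite F" and finK: "finite K"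
    and par: "\<And>j e e'. j < f \<Longrightarrow> e \<in> F \<Longrightarrow> e' \<in> F \<Longrightarrow> x (Suc j) e = x (Suc j) e' \<Longrightarrow> x j e = x j e'"
    and nc: "\<And>j e e'. j < f \<Longrightarrow> e \<in> F \<Longrightarrow> e' \<in> F \<Longrightarrow>
               \<not> crossing (x j e) (x (Suc j) e) (x j e') (x (Suc j) e')"
    and lab: "\<And>s. card (lab ` {e \<in> F. seg K (x 0 e) = s}) \<le> 1"
  shows "\<exists>K'. finite K' \<and> K \<subseteq> K' \<and> card K' + 1 \<le> 4 ^ f * (card K + 1) \<and>
           (\<forall>s. card (lab ` {e \<in> F. seg K' (x f e) = s}) \<le> 2 ^ f)"
  using par nc
proof (induction f)
  case 0
  show ?case using finK lab by (intro exI[of _ K]) auto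
next
  case (Suc f)
  have "\<exists>L. finite L \<and> K \<subseteq> L \<and> card L + 1 \<le> 4 ^ f * (card K + 1) \<and>
          (\<forall>s. card (lab ` {e \<in> F. seg L (x f e) = s}) \<le> 2 ^ f)"
  proof (rule Suc.IH)
    show "x j e = x j e'" if "j < f" "e \<in> F" "e' \<in> F" "x (Suc j) e = x (Suc j) e'" for j e e'
      using Suc.prems(1)[OF less_SucI[OF that(1)] that(2-4)] .
    show "\<not> crossing (x j e) (x (Suc j) e) (x j e') (x (Suc j) e')"
      if "j < f" "e \<in> F" "e' \<in> F" for j e e'
      using Suc.prems(2)[OF less_SucI[OF that(1)] that(2,3)] .
  qed
  then obtain L where L: "finite L" "K \<subseteq> L" "card L + 1 \<le> 4 ^ f * (card K + 1)"
    "\<And>s. card (lab ` {e \<in> F. seg L (x f e) = s}) \<le> 2 ^ f"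
    by blast
  have "\<exists>K'. finite K' \<and> L \<subseteq> K' \<and> card K' + 1 \<le> 4 * (card L + 1) \<and>
          (\<forall>s. card (lab ` {e \<in> F. seg K' (x (Suc f) e) = s}) \<le> 2 * 2 ^ f)"
    by (rule refine_cuts[OF finF L(1) Suc.prems L(4)]) auto
  then obtain K' where K': "finite K'" "L \<subseteq> K'" "card K' + 1 \<le> 4 * (card L + 1)"
    "\<And>s. card (lab ` {e \<in> F. seg K' (x (Suc f) e) = s}) \<le> 2 * 2 ^ f"
    by blast
  have "card K' + 1 \<le> 4 ^ Suc f * (card K + 1)" using K'(3) L(3) by simp
  then show ?case using K' L(2) by (intro exI[of _ K']) auto
qed

text \<open>
  Two families of paths start in \<open>V\<close>, have lengths \<open>f\<close> and \<open>g\<close>, and are linked by one more edge.  Both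
  iterations start from cuts between neighbouring elements of \<open>V\<close>, so these cuts are
  shared by the two results and are counted once; this saves the \<open>- 1\<close>, without which the case
  \<open>f = 1\<close>, \<open>g = 0\<close> of \<open>balanced_bound\<close> would fail.  The factor 5 is 4 for links between different
  segments plus 1 for links within a segment.
\<close>
lemma card_linked_le:
  fixes x y :: "nat \<Rightarrow> 'e \<Rightarrow> nat"
  assumes finF: "finite F" and V: "finite V" "V \<noteq> {}"
    and xV: "\<And>e. e \<in> F \<Longrightarrow> x 0 e \<in> V" and yV: "\<And>e. e \<in> F \<Longrightarrow> y 0 e \<in> V"
    and inj: "inj_on (\<lambda>e. (x 0 e, y 0 e)) F"
    and parx: "\<And>j e e'. j < f \<Longrightarrow> e \<in> F \<Longrightarrow> e' \<in> F \<Longrightarrow> x (Suc j) e = x (Suc j) e' \<Longrightarrow> x j e = x j e'"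
    and pary: "\<And>j e e'. j < g \<Longrightarrow> e \<in> F \<Longrightarrow> e' \<in> F \<Longrightarrow> y (Suc j) e = y (Suc j) e' \<Longrightarrow> y j e = y j e'"
    and ncx: "\<And>j e e'. j < f \<Longrightarrow> e \<in> F \<Longrightarrow> e' \<in> F \<Longrightarrow>
                \<not> crossing (x j e) (x (Suc j) e) (x j e') (x (Suc j) e')"
    and ncy: "\<And>j e e'. j < g \<Longrightarrow> e \<in> F \<Longrightarrow> e' \<in> F \<Longrightarrow>
                \<not> crossing (y j e) (y (Suc j) e) (y j e') (y (Suc j) e')"
    and ncl: "\<And>e e'. e \<in> F \<Longrightarrow> e' \<in> F \<Longrightarrow> \<not> crossing (x f e) (y g e) (x f e') (y g e')"
  shows "card F \<le> 5 * ((4 ^ f + 4 ^ g - 1) * card V) * 2 ^ (f + g)"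
proof -
  \<comment> \<open>The leftmost point needs no cut to its left, so each of the \<open>card V\<close> segments contains one point of \<open>V\<close>.\<close>
  define K0 where "K0 = V - {Min V}"
  have finK0: "finite K0" using V by (simp add: K0_def)
  have cK0: "card K0 + 1 = card V"
    using V by (simp add: K0_def card_gt_0_iff)
  have inj0: "seg K0 a = seg K0 b \<longleftrightarrow> a = b" if "a \<in> V" "b \<in> V" for a b
  proof -
    have "seg K0 a \<noteq> seg K0 b" if "a \<in> V" "b \<in> V" "a < b" for a b
    proof
      assume "seg K0 a = seg K0 b"
      moreover have "b \<in> K0" using that Min_le[OF V(1) that(1)] unfolding K0_def by (metis DiffI leD singletonD)
      ultimately show False using seg_eqD[OF finK0] that(3) by fastforce
    qed
    then show ?thesis using that by (metis linorder_neqE_nat)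
  qed
  have base: "card (z ` {e \<in> F. seg K0 (z e) = s}) \<le> 1" if "\<And>e. e \<in> F \<Longrightarrow> z e \<in> V" for z s
  proof -
    have "\<forall>a\<in>z ` {e \<in> F. seg K0 (z e) = s}. \<forall>b\<in>z ` {e \<in> F. seg K0 (z e) = s}. a = b"
      using that inj0 by auto
    moreover have "finite (z ` {e \<in> F. seg K0 (z e) = s})" using finF by simp
    ultimately show ?thesis unfolding One_nat_def by (simp only: card_le_Suc0_iff_eq)
  qed
  have "\<exists>Kx. finite Kx \<and> K0 \<subseteq> Kx \<and> card Kx + 1 \<le> 4 ^ f * (card K0 + 1) \<and>
          (\<forall>s. card (x 0 ` {e \<in> F. seg Kx (x f e) = s}) \<le> 2 ^ f)"
    by (rule iterate_cuts[OF finF finK0 parx ncx base[OF xV]])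
  then obtain Kx where Kx: "finite Kx" "K0 \<subseteq> Kx" "card Kx + 1 \<le> 4 ^ f * card V"
    "\<And>s. card (x 0 ` {e \<in> F. seg Kx (x f e) = s}) \<le> 2 ^ f"
    unfolding cK0 by blast
  have "\<exists>Ky. finite Ky \<and> K0 \<subseteq> Ky \<and> card Ky + 1 \<le> 4 ^ g * (card K0 + 1) \<and>
          (\<forall>s. card (y 0 ` {e \<in> F. seg Ky (y g e) = s}) \<le> 2 ^ g)"
    by (rule iterate_cuts[OF finF finK0 pary ncy base[OF yV]])
  then obtain Ky where Ky: "finite Ky" "K0 \<subseteq> Ky" "card Ky + 1 \<le> 4 ^ g * card V"
    "\<And>s. card (y 0 ` {e \<in> F. seg Ky (y g e) = s}) \<le> 2 ^ g"
    unfolding cK0 by blast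
  define K where "K = Kx \<union> Ky"
  have finK: "finite K" using Kx(1) Ky(1) by (simp add: K_def)
  have cardK: "card K + 1 \<le> (4 ^ f + 4 ^ g - 1) * card V"
  proof -
    have "card K + card (Kx \<inter> Ky) = card Kx + card Ky"
      unfolding K_def using card_Un_Int[OF Kx(1) Ky(1)] by simp
    moreover have "card K0 \<le> card (Kx \<inter> Ky)" using Kx Ky by (intro card_mono) auto
    ultimately have "card K + 1 + card V \<le> 4 ^ f * card V + 4 ^ g * card V"
      using cK0 Kx(3) Ky(3) by linarith
    then show ?thesis by (simp add: diff_mult_distrib add_mult_distrib)
  qed
  let ?st = "\<lambda>e. (seg K (x f e), seg K (y g e))"
  define P where "P = ?st ` F"
  have finP: "finite P" using finF by (simp add: P_def)
  have "card P \<le> 5 * (card K + 1)"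
  proof -
    define A where "A = P - Id"
    have finA: "finite A" using finP by (simp add: A_def)
    have "card A \<le> 4 * card (Field A)"
    proof (rule card_noncrossing_relation[OF finA])
      fix a b c d assume "(a, b) \<in> A" "(c, d) \<in> A"
      then obtain e e' where "e \<in> F" "e' \<in> F" "(a, b) = ?st e" "(c, d) = ?st e'"
        by (auto simp: A_def P_def)
      then show "\<not> crossing a b c d" using crossing_seg[OF finK] ncl by blast
    qed (simp add: A_def)
    moreover have "Field A \<subseteq> {..card K}"
      using seg_le_card[OF finK] by (auto simp: A_def P_def Field_def)
    then have "card (Field A) \<le> card K + 1" using card_mono[of "{..card K}"] by fastforce
    moreover have "card (P \<inter> Id) \<le> card K + 1"
    proof -
      have "P \<inter> Id \<subseteq> (\<lambda>s. (s, s)) ` {..card K}" using seg_le_card[OF finK] by (auto simp: P_def)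
      then have "card (P \<inter> Id) \<le> card ((\<lambda>s. (s, s)) ` {..card K})" by (intro card_mono) auto
      also have "\<dots> \<le> card {..card K}" by (rule card_image_le) simp
      finally show ?thesis by simp
    qed
    moreover have "card P = card A + card (P \<inter> Id)"
      unfolding A_def using finP by (metis card_Diff_subset_Int card_mono finite_Int inf_le1 le_add_diff_inverse2)
    ultimately show ?thesis by simp
  qed
  have fib: "card {e \<in> F. ?st e = q} \<le> 2 ^ (f + g)" for q
  proof (cases "\<exists>e0\<in>F. ?st e0 = q")
    case False
    then have "{e \<in> F. ?st e = q} = {}" by blast
    then show ?thesis by (metis card.empty le0)
  next
    case True
    then obtain e0 where e0: "e0 \<in> F" "?st e0 = q" by blast
    let ?X = "x 0 ` {e \<in> F. seg Kx (x f e) = seg Kx (x f e0)}"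
    let ?Y = "y 0 ` {e \<in> F. seg Ky (y g e) = seg Ky (y g e0)}"
    have "card {e \<in> F. ?st e = q} \<le> card (?X \<times> ?Y)"
    proof (rule card_inj_on_le)
      show "inj_on (\<lambda>e. (x 0 e, y 0 e)) {e \<in> F. ?st e = q}"
        using inj by (rule inj_on_subset) auto
      show "(\<lambda>e. (x 0 e, y 0 e)) ` {e \<in> F. ?st e = q} \<subseteq> ?X \<times> ?Y"
      proof
        fix r assume "r \<in> (\<lambda>e. (x 0 e, y 0 e)) ` {e \<in> F. ?st e = q}"
        then obtain e where e: "e \<in> F" "?st e = q" "r = (x 0 e, y 0 e)" by blast
        then have "seg K (x f e) = seg K (x f e0)" "seg K (y g e) = seg K (y g e0)" using e0 by auto
        then have "seg Kx (x f e) = seg Kx (x f e0)" "seg Ky (y g e) = seg Ky (y g e0)"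
          by (auto simp: K_def intro: seg_eq_subset[OF finK])
        then show "r \<in> ?X \<times> ?Y" using e(1,3) by blast
      qed
      show "finite (?X \<times> ?Y)" using finF by simp
    qed
    also have "\<dots> \<le> 2 ^ f * 2 ^ g"
      unfolding card_cartesian_product by (rule mult_le_mono[OF Kx(4) Ky(4)])
    finally show ?thesis by (simp add: power_add)
  qed
  have "F = (\<Union>q\<in>P. {e \<in> F. ?st e = q})" by (auto simp: P_def)
  then have "card F = card (\<Union>q\<in>P. {e \<in> F. ?st e = q})" by (rule arg_cong)
  also have "\<dots> \<le> (\<Sum>q\<in>P. card {e \<in> F. ?st e = q})" by (rule card_UN_le[OF finP])
  also have "\<dots> \<le> (\<Sum>q\<in>P. 2 ^ (f + g))" by (rule sum_mono) (rule fib)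
  also have "\<dots> = card P * 2 ^ (f + g)" by simp
  also have "\<dots> \<le> 5 * ((4 ^ f + 4 ^ g - 1) * card V) * 2 ^ (f + g)"
  proof (rule mult_le_mono1)
    show "card P \<le> 5 * ((4 ^ f + 4 ^ g - 1) * card V)"
      using \<open>card P \<le> 5 * (card K + 1)\<close> cardK by (meson le_trans mult_le_mono2)
  qed
  finally show ?thesis .
qed

lemma sixteen_twentyfive: "1 \<le> f \<Longrightarrow> 5 * 16 ^ f \<le> (4 * 25 ^ f :: nat)"
  by (induction f rule: dec_induct) auto

text \<open>
  Meeting in the middle balances \<open>4 ^ f\<close> against \<open>4 ^ g\<close>: the left side is then of order
  \<open>4 ^ (f + g)\<close>, and the base 5 on the right absorbs the constants.
\<close>
lemma balanced_bound:
  assumes "f = g \<or> f = Suc g"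
  shows "5 * ((4 ^ f + 4 ^ g - 1) * n) * 2 ^ (f + g) \<le> (8 * 5 ^ (f + g) * n :: nat)"
proof -
  have sq: "(4::nat) ^ g * 4 ^ g = 16 ^ g" "(5::nat) ^ g * 5 ^ g = 25 ^ g" "(2::nat) ^ g * 2 ^ g = 4 ^ g"
    by (simp_all flip: power_mult_distrib)
  have "5 * (4 ^ f + 4 ^ g - 1) * 2 ^ (f + g) \<le> (8 * 5 ^ (f + g) :: nat)"
    using assms
  proof
    assume "f = g"
    then have "5 * (4 ^ f + 4 ^ g - 1) * 2 ^ (f + g) = 10 * 16 ^ g - 5 * (4::nat) ^ g"
      by (simp add: power_add sq diff_mult_distrib algebra_simps flip: sq(1))
    also have "\<dots> \<le> 8 * 25 ^ g"
      using sixteen_twentyfive[of g] by (cases "g = 0") (simp_all add: Suc_le_eq)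
    finally show ?thesis using \<open>f = g\<close> by (simp add: power_add sq)
  next
    assume "f = Suc g"
    then have "5 * (4 ^ f + 4 ^ g - 1) * 2 ^ (f + g) = 50 * 16 ^ g - 10 * (4::nat) ^ g"
      by (simp add: power_add sq diff_mult_distrib algebra_simps flip: sq(1))
    also have "\<dots> \<le> 40 * 25 ^ g"
      using sixteen_twentyfive[of g] by (cases "g = 0") (simp_all add: Suc_le_eq)
    finally show ?thesis using \<open>f = Suc g\<close> by (simp add: power_add sq)
  qed
  then show ?thesis by (metis mult.assoc mult.commute mult_le_mono1)
qed

section \<open>Paths that change the page at every turning point\<close>

text \<open>
  The possible page sequences of paths with \<open>i\<close> turning points.
\<close>
definition page_words :: "nat \<Rightarrow> nat \<Rightarrow> nat list set" where
  "page_words k i = {w. length w = Suc i \<and> set w \<subseteq> {..<k} \<and> distinct_adj w}"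

lemma finite_page_words: "finite (page_words k i)"
  by (rule finite_subset[OF _ finite_lists_length_eq[of "{..<k}" "Suc i"]]) (auto simp: page_words_def)

lemma card_page_words: "card (page_words k i) \<le> k * (k - 1) ^ i"
proof (induction i)
  case 0
  have "page_words k 0 \<subseteq> (\<lambda>a. [a]) ` {..<k}" by (auto simp: page_words_def length_Suc_conv)
  from card_mono[OF _ this] card_image_le[of "{..<k}" "\<lambda>a. [a]"] show ?case by simp
next
  case (Suc i)
  have "page_words k (Suc i) \<subseteq> (\<Union>w\<in>page_words k i. (\<lambda>a. a # w) ` ({..<k} - {hd w}))"
  proof
    fix w assume "w \<in> page_words k (Suc i)"
    then obtain a b v where w: "w = a # b # v" "b # v \<in> page_words k i" "a < k" "a \<noteq> b"
      by (auto simp: page_words_def length_Suc_conv)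
    then have "w \<in> (\<lambda>a. a # b # v) ` ({..<k} - {hd (b # v)})" by simp
    then show "w \<in> (\<Union>w\<in>page_words k i. (\<lambda>a. a # w) ` ({..<k} - {hd w}))" using w(2) by blast
  qed
  then have "card (page_words k (Suc i)) \<le> card (\<Union>w\<in>page_words k i. (\<lambda>a. a # w) ` ({..<k} - {hd w}))"
    using finite_page_words by (intro card_mono) auto
  also have "\<dots> \<le> (\<Sum>w\<in>page_words k i. card ((\<lambda>a. a # w) ` ({..<k} - {hd w})))"
    by (rule card_UN_le[OF finite_page_words])
  also have "\<dots> \<le> (\<Sum>w\<in>page_words k i. k - 1)"
  proof (rule sum_mono)
    fix w assume "w \<in> page_words k i"
    then have "hd w \<in> {..<k}" by (cases w) (auto simp: page_words_def)
    then have "card ({..<k} - {hd w}) = k - 1" by (subst card_Diff_singleton) auto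
    then show "card ((\<lambda>a. a # w) ` ({..<k} - {hd w})) \<le> k - 1"
      using card_image_le[of "{..<k} - {hd w}" "\<lambda>a. a # w"] by simp
  qed
  also have "\<dots> \<le> k * (k - 1) ^ Suc i" using mult_le_mono1[OF Suc, of "k - 1"] by (simp add: mult_ac)
  finally show ?case .
qed

text \<open>
  Every path is counted in both directions, which explains the instances \<open>(e, b)\<close>: the page
  sequences to be summed over are the same as for one direction, so this halves the resulting bound on
  \<open>card E\<close>.  An inner point still
  belongs to one instance only, even if the page sequence is a palindrome: a path that had the same
  point at the same index in both directions would have it exactly in the middle, and the two
  edges there would lie on the same page.
\<close>
lemma card_turning_paths_le:
  fixes X :: "'e \<Rightarrow> nat \<Rightarrow> nat" and w :: "'e \<Rightarrow> nat list"
  assumes finE: "finite E" and V: "finite V" "V \<noteq> {}"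
    and words: "\<And>e. e \<in> E \<Longrightarrow> \<exists>i\<le>t. w e \<in> page_words k i"
    and endV: "\<And>e. e \<in> E \<Longrightarrow> X e 0 \<in> V \<and> X e (length (w e)) \<in> V"
    and injX: "\<And>e. e \<in> E \<Longrightarrow> inj_on (X e) {..length (w e)}"
    and disj: "\<And>e e' j j'. e \<in> E \<Longrightarrow> e' \<in> E \<Longrightarrow> e \<noteq> e' \<Longrightarrow> 0 < j \<Longrightarrow> j < length (w e) \<Longrightarrow>
                 0 < j' \<Longrightarrow> j' < length (w e') \<Longrightarrow> X e j \<noteq> X e' j'"
    and ends: "\<And>e e'. e \<in> E \<Longrightarrow> e' \<in> E \<Longrightarrow>
                 {X e 0, X e (length (w e))} = {X e' 0, X e' (length (w e'))} \<Longrightarrow> e = e'"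
    and nc: "\<And>e e' j j'. e \<in> E \<Longrightarrow> e' \<in> E \<Longrightarrow> j < length (w e) \<Longrightarrow> j' < length (w e') \<Longrightarrow>
               w e ! j = w e' ! j' \<Longrightarrow> \<not> crossing (X e j) (X e (Suc j)) (X e' j') (X e' (Suc j'))"
  shows "card E \<le> (\<Sum>i\<le>t. 4 * k * (5 * (k - 1)) ^ i) * card V"
proof -
  define F where "F p = {(e, b). e \<in> E \<and> (if b then w e else rev (w e)) = p}" for p
  have finF: "finite (F p)" for p
    by (rule finite_subset[of _ "E \<times> UNIV"]) (use finE in \<open>auto simp: F_def\<close>)
  have cardF: "card (F p) \<le> 8 * 5 ^ i * card V" if p: "p \<in> page_words k i" for p i
  proof -
    define Z where "Z = (\<lambda>j (e, b). if b then X e j else X e (Suc i - j))"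
    \<comment> \<open>The \<open>f\<close> first points are reached from the front and the \<open>g\<close> last ones from the back.\<close>
    define f where "f = i - i div 2"
    define g where "g = i div 2"
    have fg: "f + g = i" "f = g \<or> f = Suc g" by (auto simp: f_def g_def)
    have lenp: "length p = Suc i" and dp: "distinct_adj p" using p by (auto simp: page_words_def)
    have len: "length (w e) = Suc i" if "(e, b) \<in> F p" for e b
      using that lenp by (auto simp: F_def split: if_splits)
    have inE: "e \<in> E" if "(e, b) \<in> F p" for e b using that by (simp add: F_def)
    have uniq: "\<epsilon> = \<epsilon>'" if h: "\<epsilon> \<in> F p" "\<epsilon>' \<in> F p" "0 < a" "a \<le> i" "Z a \<epsilon> = Z a \<epsilon>'" for \<epsilon> \<epsilon>' a
    proof -
      obtain e b e' b' where eq: "\<epsilon> = (e, b)" "\<epsilon>' = (e', b')" by (cases \<epsilon>, cases \<epsilon>') auto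
      let ?r = "\<lambda>b. if b then a else Suc i - a"
      have X: "X e (?r b) = X e' (?r b')" using h(5) by (simp add: Z_def eq split: if_splits)
      have ee: "e = e'"
      proof (rule ccontr)
        assume ne: "e \<noteq> e'"
        have F: "(e, b) \<in> F p" "(e', b') \<in> F p" using h(1,2) eq by auto
        have "X e (?r b) \<noteq> X e' (?r b')"
          by (rule disj[OF inE[OF F(1)] inE[OF F(2)] ne]) (use h(3,4) len F in auto)
        then show False using X by contradiction
      qed
      have "b = b'"
      proof (rule ccontr)
        assume ne: "b \<noteq> b'"
        have "?r b = ?r b'"
          using inj_onD[OF injX[OF inE[OF h(1)[unfolded eq]]], of "?r b" "?r b'"] X h(3,4) len h(1) ee
          unfolding eq by auto
        then have i: "i + 1 = 2 * a" using ne h(3,4) by (auto split: if_splits)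
        have "rev p = p" using h(1,2) ee ne unfolding eq F_def by (cases b; cases b') auto
        then have "p ! (a - 1) = rev p ! (a - 1)" by simp
        also have "\<dots> = p ! a" using i h(3) lenp by (simp add: rev_nth)
        finally show False
          using distinct_adj_conv_nth[of p] dp i h(3) lenp by (metis Suc_pred' h(4) less_Suc_eq_le)
      qed
      then show ?thesis using ee eq by simp
    qed
    have ncZ: "\<not> crossing (Z j \<epsilon>) (Z (Suc j) \<epsilon>) (Z j \<epsilon>') (Z (Suc j) \<epsilon>')"
      if h: "\<epsilon> \<in> F p" "\<epsilon>' \<in> F p" "j \<le> i" for \<epsilon> \<epsilon>' j
    proof -
      obtain e b e' b' where eq: "\<epsilon> = (e, b)" "\<epsilon>' = (e', b')" by (cases \<epsilon>, cases \<epsilon>') auto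
      let ?r = "\<lambda>b. if b then j else i - j"
      have pg: "w e ! ?r b = p ! j" if "(e, b) \<in> F p" for e b
        using that h(3) lenp len[OF that] by (auto simp: F_def rev_nth)
      have "\<not> crossing (X e (?r b)) (X e (Suc (?r b))) (X e' (?r b')) (X e' (Suc (?r b')))"
        by (rule nc) (use h eq pg len inE in \<open>auto simp: le_imp_diff_is_add\<close>)
      then show ?thesis using h(3) by (auto simp: Z_def eq Suc_diff_le crossing_commute split: if_splits)
    qed
    have "card (F p) \<le> 5 * ((4 ^ f + 4 ^ g - 1) * card V) * 2 ^ (f + g)"
    proof (rule card_linked_le[OF finF V, where x = Z and y = "\<lambda>j. Z (Suc i - j)"])
      show "Z 0 \<epsilon> \<in> V" "Z (Suc i - 0) \<epsilon> \<in> V" if "\<epsilon> \<in> F p" for \<epsilon>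
        using that endV len inE by (cases \<epsilon>; force simp: Z_def)+
      show "inj_on (\<lambda>\<epsilon>. (Z 0 \<epsilon>, Z (Suc i - 0) \<epsilon>)) (F p)"
      proof (rule inj_onI)
        fix \<epsilon> \<epsilon>' assume h: "\<epsilon> \<in> F p" "\<epsilon>' \<in> F p" "(Z 0 \<epsilon>, Z (Suc i - 0) \<epsilon>) = (Z 0 \<epsilon>', Z (Suc i - 0) \<epsilon>')"
        obtain e b e' b' where eq: "\<epsilon> = (e, b)" "\<epsilon>' = (e', b')" by (cases \<epsilon>, cases \<epsilon>') auto
        have l: "length (w e) = Suc i" "length (w e') = Suc i" and E: "e \<in> E" "e' \<in> E"
          using len inE h(1,2) eq by auto
        have ee: "e = e'" using h(3) by (intro ends[OF E]) (auto simp: l Z_def eq split: if_splits)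
        have "X e 0 \<noteq> X e (Suc i)" using inj_onD[OF injX[OF E(1)], of 0 "Suc i"] l by auto
        then show "\<epsilon> = \<epsilon>'" using h(3) ee by (auto simp: Z_def eq split: if_splits)
      qed
      show "Z j \<epsilon> = Z j \<epsilon>'" if "j < f" "\<epsilon> \<in> F p" "\<epsilon>' \<in> F p" "Z (Suc j) \<epsilon> = Z (Suc j) \<epsilon>'" for j \<epsilon> \<epsilon>'
        using uniq[OF that(2,3) _ _ that(4)] that(1) fg by simp
      show "Z (Suc i - j) \<epsilon> = Z (Suc i - j) \<epsilon>'"
        if "j < g" "\<epsilon> \<in> F p" "\<epsilon>' \<in> F p" "Z (Suc i - Suc j) \<epsilon> = Z (Suc i - Suc j) \<epsilon>'" for j \<epsilon> \<epsilon>'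
        using uniq[OF that(2,3) _ _ that(4)] that(1) fg by simp
      show "\<not> crossing (Z j \<epsilon>) (Z (Suc j) \<epsilon>) (Z j \<epsilon>') (Z (Suc j) \<epsilon>')"
        if "j < f" "\<epsilon> \<in> F p" "\<epsilon>' \<in> F p" for j \<epsilon> \<epsilon>'
        using ncZ[OF that(2,3)] that(1) fg by simp
      show "\<not> crossing (Z (Suc i - j) \<epsilon>) (Z (Suc i - Suc j) \<epsilon>) (Z (Suc i - j) \<epsilon>') (Z (Suc i - Suc j) \<epsilon>')"
        if "j < g" "\<epsilon> \<in> F p" "\<epsilon>' \<in> F p" for j \<epsilon> \<epsilon>'
        using ncZ[OF that(2,3), of "i - j"] that(1) fg by (simp add: Suc_diff_le crossing_commute)
      show "\<not> crossing (Z f \<epsilon>) (Z (Suc i - g) \<epsilon>) (Z f \<epsilon>') (Z (Suc i - g) \<epsilon>')"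
        if "\<epsilon> \<in> F p" "\<epsilon>' \<in> F p" for \<epsilon> \<epsilon>'
      proof -
        have "Suc i - g = Suc f" "f \<le> i" using fg(1) by simp_all
        then show ?thesis using ncZ[OF that, of f] by simp
      qed
    qed
    also have "\<dots> \<le> 8 * 5 ^ (f + g) * card V" by (rule balanced_bound[OF fg(2)])
    finally show ?thesis using fg(1) by simp
  qed
  let ?G = "\<Union>i\<in>{..t}. \<Union>p\<in>page_words k i. F p"
  have "E \<times> UNIV \<subseteq> ?G"
  proof clarify
    fix e :: 'e and b :: bool assume e: "e \<in> E"
    obtain i where i: "i \<le> t" "w e \<in> page_words k i" using words[OF e] by blast
    then have "(if b then w e else rev (w e)) \<in> page_words k i" by (auto simp: page_words_def)
    moreover have "(e, b) \<in> F (if b then w e else rev (w e))" using e by (simp add: F_def)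
    ultimately show "(e, b) \<in> ?G" using i(1) by blast
  qed
  then have "card (E \<times> (UNIV :: bool set)) \<le> card ?G"
    using finF finite_page_words by (intro card_mono) auto
  also have "\<dots> \<le> (\<Sum>i\<le>t. card (\<Union>p\<in>page_words k i. F p))" by (rule card_UN_le) simp
  also have "\<dots> \<le> (\<Sum>i\<le>t. 8 * k * (5 * (k - 1)) ^ i * card V)"
  proof (rule sum_mono)
    fix i
    have "card (\<Union>p\<in>page_words k i. F p) \<le> (\<Sum>p\<in>page_words k i. card (F p))"
      by (rule card_UN_le[OF finite_page_words])
    also have "\<dots> \<le> (\<Sum>p\<in>page_words k i. 8 * 5 ^ i * card V)" by (rule sum_mono) (rule cardF)
    also have "\<dots> = card (page_words k i) * (8 * 5 ^ i * card V)" by simp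
    also have "\<dots> \<le> k * (k - 1) ^ i * (8 * 5 ^ i * card V)" by (rule mult_le_mono1[OF card_page_words])
    also have "\<dots> = 8 * k * (5 * (k - 1)) ^ i * card V" by (simp add: power_mult_distrib mult_ac)
    finally show "card (\<Union>p\<in>page_words k i. F p) \<le> 8 * k * (5 * (k - 1)) ^ i * card V" .
  qed
  also have "\<dots> = 2 * ((\<Sum>i\<le>t. 4 * k * (5 * (k - 1)) ^ i) * card V)"
    by (simp add: sum_distrib_left sum_distrib_right mult_ac)
  finally show ?thesis by (simp add: card_cartesian_product)
qed

section \<open>Merging edges on the same page\<close>

text \<open>
  The edge \<open>p q\<close> separates \<open>r\<close> from \<open>s\<close> on the spine only by crossing the edge \<open>r s\<close>.
\<close>
lemma not_crossing_same_side:
  assumes "\<not> crossing p q r s" "\<not> crossing r s p q" "p \<noteq> r" "q \<noteq> r" "p \<noteq> s" "q \<noteq> s"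
  shows "(p < r \<longleftrightarrow> q < r) \<longleftrightarrow> (p < s \<longleftrightarrow> q < s)"
proof -
  have *: "(p < r \<longleftrightarrow> q < r) \<longleftrightarrow> (p < s \<longleftrightarrow> q < s)"
    if "\<not> crossing p q r s" "\<not> crossing r s p q" "p \<noteq> r" "q \<noteq> r" "p \<noteq> s" "q \<noteq> s" "p \<le> q" "r \<le> s"
    for p q r s
    using that unfolding crossing_def by (simp add: min_absorb1 max_absorb2) linarith
  have "\<not> crossing q p r s" "\<not> crossing r s q p" "\<not> crossing p q s r" "\<not> crossing s r p q"
    "\<not> crossing q p s r" "\<not> crossing s r q p"
    using assms(1,2) by (simp_all add: crossing_commute)
  then consider "(p < r \<longleftrightarrow> q < r) \<longleftrightarrow> (p < s \<longleftrightarrow> q < s)" | "(q < r \<longleftrightarrow> p < r) \<longleftrightarrow> (q < s \<longleftrightarrow> p < s)"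
    | "(p < s \<longleftrightarrow> q < s) \<longleftrightarrow> (p < r \<longleftrightarrow> q < r)" | "(q < s \<longleftrightarrow> p < s) \<longleftrightarrow> (q < r \<longleftrightarrow> p < r)"
    using *[of p q r s] *[of q p r s] *[of p q s r] *[of q p s r] assms nat_le_linear by metis
  then show ?thesis by cases blast+
qed

text \<open>
  Every edge of the walk \<open>a\<close> spans both or none of the two ends of the walk \<open>b\<close>, since \<open>b\<close> can neither
  enter nor leave the interval below that edge.  Hence along \<open>a\<close>, the property of lying between the two ends of \<open>b\<close>
  never changes.
\<close>
lemma crossing_walks:
  fixes a b :: "nat \<Rightarrow> nat"
  assumes st: "s \<le> t" "s' \<le> t'"
    and disj: "\<And>l l'. s \<le> l \<Longrightarrow> l \<le> t \<Longrightarrow> s' \<le> l' \<Longrightarrow> l' \<le> t' \<Longrightarrow> a l \<noteq> b l'"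
    and nc: "\<And>l l'. s \<le> l \<Longrightarrow> l < t \<Longrightarrow> s' \<le> l' \<Longrightarrow> l' < t' \<Longrightarrow>
               \<not> crossing (a l) (a (Suc l)) (b l') (b (Suc l')) \<and>
               \<not> crossing (b l') (b (Suc l')) (a l) (a (Suc l))"
  shows "\<not> crossing (a s) (a t) (b s') (b t')"
proof -
  have sides: "((a l < b s') = (a (Suc l) < b s')) = ((a l < b l') = (a (Suc l) < b l'))"
    if l: "s \<le> l" "l < t" and l': "s' \<le> l'" "l' \<le> t'" for l l'
    using l'
  proof (induction l' rule: dec_induct)
    case (step n)
    then have "\<not> crossing (a l) (a (Suc l)) (b n) (b (Suc n))"
      "\<not> crossing (b n) (b (Suc n)) (a l) (a (Suc l))"
      "a l \<noteq> b n" "a (Suc l) \<noteq> b n" "a l \<noteq> b (Suc n)" "a (Suc l) \<noteq> b (Suc n)"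
      using nc[OF l, of n] disj[of l n] disj[of "Suc l" n] disj[of l "Suc n"] disj[of "Suc l" "Suc n"] l
      by auto
    then have "((a l < b n) = (a (Suc l) < b n)) = ((a l < b (Suc n)) = (a (Suc l) < b (Suc n)))"
      by (rule not_crossing_same_side)
    then show ?case using step by simp
  qed simp
  have "((a s < b s') = (a s < b t')) = ((a l < b s') = (a l < b t'))" if "s \<le> l" "l \<le> t" for l
    using that
  proof (induction l rule: dec_induct)
    case (step n)
    then show ?case using sides[of n t'] st(2) by auto
  qed simp
  from this[of t] have "((a s < b s') = (a s < b t')) = ((a t < b s') = (a t < b t'))" using st(1) by simp
  moreover have "a s \<noteq> b s'" "a s \<noteq> b t'" "a t \<noteq> b s'" "a t \<noteq> b t'" using disj st by simp_all
  ultimately show ?thesis unfolding crossing_def by linarith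
qed

text \<open>
  The block of the \<open>j\<close>-th entry of \<open>remdups_adj ps\<close> is the index range from \<open>T j\<close> to before \<open>T (Suc j)\<close>.
\<close>
lemma remdups_adj_blocks:
  fixes ps :: "'b list"
  defines "w \<equiv> remdups_adj ps"
  obtains T :: "nat \<Rightarrow> nat" where "T 0 = 0" "T (length w) = length ps"
    "\<And>j. j < length w \<Longrightarrow> T j < T (Suc j)"
    "\<And>j l. j < length w \<Longrightarrow> T j \<le> l \<Longrightarrow> l < T (Suc j) \<Longrightarrow> ps ! l = w ! j"
proof -
  let ?m = "length ps" and ?n = "length w"
  obtain f :: "nat \<Rightarrow> nat" where f: "mono f" "f ` {0..<?m} = {0..<?n}" "\<And>l. l < ?m \<Longrightarrow> ps ! l = w ! f l"
    using iffD1[OF remdups_adj_altdef[of ps w]] unfolding w_def by auto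
  define T where "T j = (LEAST l. ?m \<le> l \<or> j \<le> f l)" for j
  have T1: "?m \<le> T j \<or> j \<le> f (T j)" for j unfolding T_def by (rule LeastI[of _ ?m]) simp
  have T2: "l < ?m \<and> f l < j" if "l < T j" for l j
    using not_less_Least[of l "\<lambda>l. ?m \<le> l \<or> j \<le> f l"] that unfolding T_def by auto
  have Tm: "T j \<le> ?m" for j using T2[of ?m j] by (meson not_le less_irrefl)
  have T3: "j \<le> f l" if "T j \<le> l" "l < ?m" for l j
    using T1[of j] that monoD[OF f(1) that(1)] by linarith
  have fn: "f l < ?n" if "l < ?m" for l using f(2) that by (metis atLeastLessThan_iff imageI zero_le)
  show thesis
  proof (rule that[of T])
    show "T 0 = 0" using T2[of 0 0] by fastforce
    show "T ?n = ?m" using T1[of ?n] Tm[of ?n] fn[of "T ?n"] by linarith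
    show "T j < T (Suc j)" if j: "j < ?n" for j
    proof -
      have "j \<in> f ` {0..<?m}" using j f(2) by simp
      then obtain l where l: "l < ?m" "f l = j" by auto
      have "T j \<le> l" using T2[of l j] l(2) by (meson not_le less_irrefl)
      moreover have "l < T (Suc j)" using T3[of "Suc j" l] l by fastforce
      ultimately show ?thesis by simp
    qed
    show "ps ! l = w ! j" if "T j \<le> l" "l < T (Suc j)" for j l
      using T2[OF that(2)] T3[OF that(1)] f(3)[of l] by (simp add: le_antisym less_Suc_eq_le)
  qed
qed

text \<open>
  The turning points of a path are the ends of its maximal stretches on one page.  If two merged
  arcs on the same page crossed, their four ends would be distinct; but distinct
  stretches of one path, or stretches of internally disjoint paths, can only meet in their ends, so the stretches would be
  disjoint, contrary to \<open>crossing_walks\<close>.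
\<close>
lemma card_paths_le:
  fixes q :: "'e \<Rightarrow> nat \<Rightarrow> nat" and m :: "'e \<Rightarrow> nat" and page :: "'e \<Rightarrow> nat \<Rightarrow> nat"
  assumes finE: "finite E" and V: "finite V" "V \<noteq> {}"
    and m: "\<And>e. e \<in> E \<Longrightarrow> 0 < m e \<and> m e \<le> Suc t"
    and page: "\<And>e l. e \<in> E \<Longrightarrow> l < m e \<Longrightarrow> page e l < k"
    and injq: "\<And>e. e \<in> E \<Longrightarrow> inj_on (q e) {..m e}"
    and endV: "\<And>e. e \<in> E \<Longrightarrow> q e 0 \<in> V \<and> q e (m e) \<in> V"
    and inner: "\<And>e l. e \<in> E \<Longrightarrow> 0 < l \<Longrightarrow> l < m e \<Longrightarrow> q e l \<notin> V"
    and disj: "\<And>e e' l l'. e \<in> E \<Longrightarrow> e' \<in> E \<Longrightarrow> e \<noteq> e' \<Longrightarrow> 0 < l \<Longrightarrow> l < m e \<Longrightarrow>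
                 0 < l' \<Longrightarrow> l' < m e' \<Longrightarrow> q e l \<noteq> q e' l'"
    and ends: "\<And>e e'. e \<in> E \<Longrightarrow> e' \<in> E \<Longrightarrow> {q e 0, q e (m e)} = {q e' 0, q e' (m e')} \<Longrightarrow> e = e'"
    and nc: "\<And>e e' l l'. e \<in> E \<Longrightarrow> e' \<in> E \<Longrightarrow> l < m e \<Longrightarrow> l' < m e' \<Longrightarrow> page e l = page e' l' \<Longrightarrow>
               \<not> crossing (q e l) (q e (Suc l)) (q e' l') (q e' (Suc l'))"
  shows "card E \<le> (\<Sum>i\<le>t. 4 * k * (5 * (k - 1)) ^ i) * card V"
proof -
  define ps where "ps e = map (page e) [0..<m e]" for e
  define w where "w e = remdups_adj (ps e)" for e
  have "\<forall>e. \<exists>T. T 0 = 0 \<and> T (length (w e)) = m e \<and> (\<forall>j<length (w e). T j < T (Suc j)) \<and>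
          (\<forall>j<length (w e). \<forall>l. T j \<le> l \<and> l < T (Suc j) \<longrightarrow> ps e ! l = w e ! j)"
  proof
    fix e
    obtain T where "T 0 = 0" "T (length (w e)) = length (ps e)"
      "\<And>j. j < length (w e) \<Longrightarrow> T j < T (Suc j)"
      "\<And>j l. j < length (w e) \<Longrightarrow> T j \<le> l \<Longrightarrow> l < T (Suc j) \<Longrightarrow> ps e ! l = w e ! j"
      using remdups_adj_blocks[of "ps e"] unfolding w_def by metis
    then show "\<exists>T. T 0 = 0 \<and> T (length (w e)) = m e \<and> (\<forall>j<length (w e). T j < T (Suc j)) \<and>
          (\<forall>j<length (w e). \<forall>l. T j \<le> l \<and> l < T (Suc j) \<longrightarrow> ps e ! l = w e ! j)"
      by (intro exI[of _ T]) (simp add: ps_def)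
  qed
  then obtain T :: "'e \<Rightarrow> nat \<Rightarrow> nat" where T: "\<And>e. T e 0 = 0" "\<And>e. T e (length (w e)) = m e"
    "\<And>e j. j < length (w e) \<Longrightarrow> T e j < T e (Suc j)"
    "\<And>e j l. j < length (w e) \<Longrightarrow> T e j \<le> l \<Longrightarrow> l < T e (Suc j) \<Longrightarrow> ps e ! l = w e ! j"
    by metis
  have Tless: "T e i < T e j" if "i < j" "j \<le> length (w e)" for e i j
    using that
  proof (induction j)
    case (Suc j)
    then show ?case using T(3)[of j e] by (cases "i = j") auto
  qed simp
  have Tm: "T e j \<le> m e" if "j \<le> length (w e)" for e j
    using Tless[of j "length (w e)" e] T(2) that by (metis le_eq_less_or_eq)
  have Tpos: "0 < T e j" "T e j < m e" if "0 < j" "j < length (w e)" for e j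
    using Tless[of 0 j e] Tless[of j "length (w e)" e] T(1,2) that by simp_all
  have pgT: "page e l = w e ! j" if "j < length (w e)" "T e j \<le> l" "l < T e (Suc j)" for e j l
    using T(4)[OF that] Tm[of "Suc j" e] that by (simp add: ps_def)
  show ?thesis
  proof (rule card_turning_paths_le[where X = "\<lambda>e j. q e (T e j)" and w = w and E = E, OF finE V])
    fix e assume e: "e \<in> E"
    have "set (ps e) \<subseteq> {..<k}" using page[OF e] by (auto simp: ps_def)
    moreover have "length (w e) \<le> Suc t" using remdups_adj_length[of "ps e"] m[OF e] by (simp add: w_def ps_def)
    moreover have "length (w e) \<noteq> 0" using m[OF e] by (simp add: w_def ps_def)
    ultimately show "\<exists>i\<le>t. w e \<in> page_words k i"
      by (intro exI[of _ "length (w e) - 1"]) (auto simp: page_words_def w_def)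
    show "q e (T e 0) \<in> V \<and> q e (T e (length (w e))) \<in> V" using endV[OF e] T by simp
    show "inj_on (\<lambda>j. q e (T e j)) {..length (w e)}"
    proof (rule inj_onI)
      fix i j assume h: "i \<in> {..length (w e)}" "j \<in> {..length (w e)}" "q e (T e i) = q e (T e j)"
      then have "T e i = T e j" using inj_onD[OF injq[OF e] h(3)] Tm by auto
      then show "i = j" using Tless[of i j e] Tless[of j i e] h by (metis atMost_iff less_irrefl linorder_neqE_nat)
    qed
  next
    fix e e' j j' assume "e \<in> E" "e' \<in> E" "e \<noteq> e'" "0 < j" "j < length (w e)" "0 < j'" "j' < length (w e')"
    then show "q e (T e j) \<noteq> q e' (T e' j')" using Tpos by (intro disj) auto
  next
    fix e e' assume "e \<in> E" "e' \<in> E"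
      "{q e (T e 0), q e (T e (length (w e)))} = {q e' (T e' 0), q e' (T e' (length (w e')))}"
    then show "e = e'" using ends T(1,2) by simp
  next
    fix e e' j j'
    assume h: "e \<in> E" "e' \<in> E" "j < length (w e)" "j' < length (w e')" "w e ! j = w e' ! j'"
    let ?a = "T e j" and ?b = "T e (Suc j)" and ?a' = "T e' j'" and ?b' = "T e' (Suc j')"
    have bm: "?b \<le> m e" "?b' \<le> m e'" using Tm h by simp_all
    have ab: "?a < ?b" "?a' < ?b'" using T(3) h by simp_all
    show "\<not> crossing (q e ?a) (q e ?b) (q e' ?a') (q e' ?b')"
    proof
      assume cr: "crossing (q e ?a) (q e ?b) (q e' ?a') (q e' ?b')"
      then have ne: "q e ?a \<noteq> q e' ?a'" "q e ?a \<noteq> q e' ?b'" "q e ?b \<noteq> q e' ?a'" "q e ?b \<noteq> q e' ?b'"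
        by (auto simp: crossing_def)
      have "q e l \<noteq> q e' l'" if l: "?a \<le> l" "l \<le> ?b" "?a' \<le> l'" "l' \<le> ?b'" for l l'
      proof
        assume eq: "q e l = q e' l'"
        show False
        proof (cases "e = e'")
          case True
          then have ll: "l = l'" using inj_onD[OF injq[OF h(1)], of l l'] eq l bm by auto
          have "j \<noteq> j'" using ne True by auto
          then consider "j < j'" | "j' < j" by linarith
          then show False
          proof cases
            case 1
            then have "?b \<le> ?a'" using Tless[of "Suc j" j' e] h(4) True by (cases "Suc j = j'") auto
            then have "?b = ?a'" using l ll by simp
            then show False using ne(3) True by simp
          next
            case 2
            then have "?b' \<le> ?a" using Tless[of "Suc j'" j e] h(3) True by (cases "Suc j' = j") auto
            then have "?b' = ?a" using l ll by simp
            then show False using ne(2) True by simp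
          qed
        next
          case False
          have lm: "l \<le> m e" "l' \<le> m e'" using l bm by simp_all
          have "l = 0 \<or> l = m e \<or> 0 < l \<and> l < m e" "l' = 0 \<or> l' = m e' \<or> 0 < l' \<and> l' < m e'"
            using lm by linarith+
          moreover have "\<not> (0 < l \<and> l < m e \<and> 0 < l' \<and> l' < m e')" using disj[OF h(1,2) False] eq by blast
          moreover have "\<not> (0 < l \<and> l < m e \<and> (l' = 0 \<or> l' = m e'))"
            using inner[OF h(1), of l] endV[OF h(2)] eq by metis
          moreover have "\<not> (0 < l' \<and> l' < m e' \<and> (l = 0 \<or> l = m e))"
            using inner[OF h(2), of l'] endV[OF h(1)] eq by metis
          ultimately have "(l = 0 \<or> l = m e) \<and> (l' = 0 \<or> l' = m e')" by blast
          then have "(l = ?a \<or> l = ?b) \<and> (l' = ?a' \<or> l' = ?b')" using l bm by auto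
          then show False using ne eq by auto
        qed
      qed
      moreover have "\<not> crossing (q e l) (q e (Suc l)) (q e' l') (q e' (Suc l')) \<and>
          \<not> crossing (q e' l') (q e' (Suc l')) (q e l) (q e (Suc l))"
        if l: "?a \<le> l" "l < ?b" "?a' \<le> l'" "l' < ?b'" for l l'
      proof -
        have "page e l = page e' l'" using pgT[OF h(3) l(1,2)] pgT[OF h(4) l(3,4)] h(5) by simp
        then show ?thesis using nc[OF h(1,2), of l l'] nc[OF h(2,1), of l' l] l bm by simp
      qed
      ultimately have "\<not> crossing (q e ?a) (q e ?b) (q e' ?a') (q e' ?b')"
        using ab by (intro crossing_walks) auto
      then show False using cr by contradiction
    qed
  qed
qed

section \<open>Subdivisions in stack graphs\<close>

text \<open>
  The position of a vertex is the number of its predecessors in the spine order.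
\<close>
lemma stack_graph_positions:
  assumes "stack_graph k G"
  obtains pos :: "'a \<Rightarrow> nat" and page :: "'a set \<Rightarrow> nat"
  where "inj_on pos (verts G)" "\<And>e. e \<in> edges G \<Longrightarrow> page e < k"
    "\<And>a b c d. {a, b} \<in> edges G \<Longrightarrow> {c, d} \<in> edges G \<Longrightarrow> page {a, b} = page {c, d} \<Longrightarrow>
       \<not> crossing (pos a) (pos b) (pos c) (pos d)"
proof -
  let ?V = "verts G"
  obtain R P where lay: "stack_layout k G R P" and simp: "simple_graph G"
    using assms by (auto simp: stack_graph_def)
  have lin: "linear_order_on ?V R" and PE: "(\<Union>i<k. P i) = edges G"
    and ncr: "\<And>i e f. i < k \<Longrightarrow> e \<in> P i \<Longrightarrow> f \<in> P i \<Longrightarrow> \<not> crosses R e f"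
    using lay by (auto simp: stack_layout_def)
  have finV: "finite ?V" using simp by (simp add: simple_graph_def)
  have anti: "antisym R" and trans: "trans R" and tot: "total_on ?V R" and refl: "refl_on ?V R"
    using lin by (auto simp: linear_order_on_def partial_order_on_def preorder_on_def)
  define pos where "pos x = card {y \<in> ?V. (y, x) \<in> R \<and> y \<noteq> x}" for x
  have pos_less: "pos x < pos y" if "x \<in> ?V" "(x, y) \<in> R" "x \<noteq> y" for x y
  proof -
    have "{z \<in> ?V. (z, x) \<in> R \<and> z \<noteq> x} \<subset> {z \<in> ?V. (z, y) \<in> R \<and> z \<noteq> y}"
    proof (rule psubsetI)
      show "{z \<in> ?V. (z, x) \<in> R \<and> z \<noteq> x} \<subseteq> {z \<in> ?V. (z, y) \<in> R \<and> z \<noteq> y}"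
        using that transD[OF trans] antisymD[OF anti] by blast
      show "{z \<in> ?V. (z, x) \<in> R \<and> z \<noteq> x} \<noteq> {z \<in> ?V. (z, y) \<in> R \<and> z \<noteq> y}"
        using that by blast
    qed
    then show ?thesis unfolding pos_def using finV by (intro psubset_card_mono) auto
  qed
  have tot': "(x, y) \<in> R \<or> (y, x) \<in> R" if "x \<in> ?V" "y \<in> ?V" for x y
    using that tot refl_onD[OF refl] unfolding total_on_def by metis
  have pos_lessD: "(x, y) \<in> R - Id" if "x \<in> ?V" "y \<in> ?V" "pos x < pos y" for x y
    using that pos_less[of y x] tot'[of x y] by (metis DiffI less_asym less_irrefl pair_in_Id_conv)
  have inj: "inj_on pos ?V"
    using pos_less tot' by (metis (no_types, lifting) inj_onI less_irrefl)
  define page where "page e = (SOME i. i < k \<and> e \<in> P i)" for e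
  have page: "page e < k \<and> e \<in> P (page e)" if "e \<in> edges G" for e
  proof -
    have "\<exists>i. i < k \<and> e \<in> P i" using that PE by blast
    then show ?thesis unfolding page_def by (rule someI_ex)
  qed
  have ends: "left_end R {a, b} = a \<and> right_end R {a, b} = b" if "a \<in> ?V" "b \<in> ?V" "(a, b) \<in> R" for a b
  proof -
    have "(a, a) \<in> R" "(b, b) \<in> R" using that refl by (auto dest: refl_onD)
    then have "(THE x. x \<in> {a, b} \<and> (\<forall>y\<in>{a, b}. (x, y) \<in> R)) = a"
      "(THE x. x \<in> {a, b} \<and> (\<forall>y\<in>{a, b}. (y, x) \<in> R)) = b"
      using that antisymD[OF anti] by (intro the_equality; blast)+
    then show ?thesis by (simp only: left_end_def right_end_def)
  qed
  have edge_ends: "left_end R {a, b} \<in> ?V \<and> right_end R {a, b} \<in> ?V \<and>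
      min (pos a) (pos b) = pos (left_end R {a, b}) \<and> max (pos a) (pos b) = pos (right_end R {a, b})"
    if "{a, b} \<in> edges G" for a b
  proof -
    have ab: "a \<in> ?V" "b \<in> ?V" using that simp by (auto simp: simple_graph_def)
    show ?thesis
    proof (cases "(a, b) \<in> R")
      case True
      then have "pos a \<le> pos b" using pos_less[of a b] ab by (cases "a = b") auto
      then show ?thesis using ends[OF ab True] ab by simp
    next
      case False
      then have ba: "(b, a) \<in> R" using tot' ab by blast
      then have "pos b \<le> pos a" using pos_less[of b a] ab by (cases "a = b") auto
      then show ?thesis using ends[OF ab(2,1) ba] ab by (simp add: insert_commute)
    qed
  qed
  have "\<not> crossing (pos a) (pos b) (pos c) (pos d)"
    if h: "{a, b} \<in> edges G" "{c, d} \<in> edges G" "page {a, b} = page {c, d}" for a b c d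
  proof
    assume "crossing (pos a) (pos b) (pos c) (pos d)"
    then have "crosses R {a, b} {c, d}"
      using edge_ends[OF h(1)] edge_ends[OF h(2)] pos_lessD unfolding crossing_def crosses_def by simp
    then show False using ncr page[OF h(1)] page[OF h(2)] h(3) by metis
  qed
  then show thesis using that[of pos page] inj page by blast
qed

lemma path_edges_nth: "Suc l < length p \<Longrightarrow> {p ! l, p ! Suc l} \<in> path_edges p"
  by (auto simp: path_edges_def)

lemma internal_verts_nth: "0 < l \<Longrightarrow> Suc l < length p \<Longrightarrow> p ! l \<in> internal_verts p"
  by (cases p) (auto simp: internal_verts_def in_set_conv_nth nth_butlast nth_Cons' intro!: exI[of _ "l - 1"])

text \<open>
  A path with at most \<open>2 * r\<close> inner vertices has at most that many turning points.
\<close>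
lemma topological_minor_card_edges:
  assumes G: "stack_graph k G" and H: "shallow_topological_minor r H G" and ne: "verts H \<noteq> {}"
  shows "card (edges H) \<le> (\<Sum>i\<le>2 * r. 4 * k * (5 * (k - 1)) ^ i) * card (verts H)"
proof -
  obtain pos page where pos: "inj_on pos (verts G)" and page: "\<And>e. e \<in> edges G \<Longrightarrow> page e < k"
    and nc: "\<And>a b c d. {a, b} \<in> edges G \<Longrightarrow> {c, d} \<in> edges G \<Longrightarrow> page {a, b} = page {c, d} \<Longrightarrow>
       \<not> crossing (pos a) (pos b) (pos c) (pos d)"
    using stack_graph_positions[OF G] by metis
  obtain S S' \<phi> where simp: "simple_graph H" and sub: "subdivision (2 * r) H S" and S'G: "subgraph S' G"
    and \<phi>: "bij_betw \<phi> (verts S) (verts S')" and \<phi>e: "edges S' = (\<lambda>e. \<phi> ` e) ` edges S"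
    using H by (auto simp: shallow_topological_minor_def isomorphic_def)
  obtain P where P: "\<And>e. e \<in> edges H \<Longrightarrow> P e \<noteq> [] \<and> distinct (P e) \<and> {hd (P e), last (P e)} = e \<and>
             length (P e) \<le> 2 * r + 2 \<and> internal_verts (P e) \<inter> verts H = {}"
    and dis: "disjoint_family_on (\<lambda>e. internal_verts (P e)) (edges H)"
    and S: "S = \<lparr>verts = verts H \<union> (\<Union>e\<in>edges H. internal_verts (P e)),
               edges = (\<Union>e\<in>edges H. path_edges (P e))\<rparr>"
    using sub by (auto simp: subdivision_def)
  have eH: "e \<subseteq> verts H \<and> card e = 2" if "e \<in> edges H" for e using that simp by (simp add: simple_graph_def)
  define \<psi> where "\<psi> = pos \<circ> \<phi>"
  have \<psi>: "inj_on \<psi> (verts S)"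
  proof -
    have "\<phi> ` verts S \<subseteq> verts G" using \<phi> S'G by (auto simp: bij_betw_def subgraph_def)
    then show ?thesis unfolding \<psi>_def using \<phi> pos by (intro comp_inj_on) (auto simp: bij_betw_def intro: inj_on_subset)
  qed
  have HS: "verts H \<subseteq> verts S" by (simp add: S)
  define m where "m e = length (P e) - 1" for e
  have len: "length (P e) = Suc (m e)" "0 < m e" if "e \<in> edges H" for e
  proof -
    show "length (P e) = Suc (m e)" using P[OF that] by (simp add: m_def)
    have "length (P e) \<noteq> 1"
    proof
      assume "length (P e) = 1"
      then obtain x where "P e = [x]" by (auto simp: length_Suc_conv)
      then have "e = {x}" using P[OF that] by auto
      then show False using eH[OF that] by simp
    qed
    then show "0 < m e" using P[OF that] by (cases "P e") (auto simp: m_def)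
  qed
  have P_ends: "{P e ! 0, P e ! m e} = e" if "e \<in> edges H" for e
    using P[OF that] hd_conv_nth[of "P e"] last_conv_nth[of "P e"] by (simp add: m_def)
  have P_inner: "P e ! l \<in> internal_verts (P e)" if "e \<in> edges H" "0 < l" "l < m e" for e l
    using internal_verts_nth[of l "P e"] len(1)[OF that(1)] that by simp
  have P_S: "P e ! l \<in> verts S" if e: "e \<in> edges H" "l \<le> m e" for e l
  proof -
    consider "l = 0 \<or> l = m e" | "0 < l" "l < m e" using e(2) by linarith
    then show ?thesis
    proof cases
      case 1
      then have "P e ! l \<in> e" using P_ends[OF e(1)] by auto
      then show ?thesis using eH[OF e(1)] HS by blast
    next
      case 2
      then show ?thesis using P_inner[OF e(1)] e(1) by (auto simp: S)
    qed
  qed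
  have P_edge: "{\<phi> (P e ! l), \<phi> (P e ! Suc l)} \<in> edges G" if e: "e \<in> edges H" "l < m e" for e l
  proof -
    have "{P e ! l, P e ! Suc l} \<in> edges S" using path_edges_nth[of l "P e"] len e by (auto simp: S)
    then have "\<phi> ` {P e ! l, P e ! Suc l} \<in> edges S'" unfolding \<phi>e by (rule imageI)
    then show ?thesis using S'G by (auto simp: subgraph_def)
  qed
  have finH: "finite (verts H)" using simp by (simp add: simple_graph_def)
  have finE: "finite (edges H)"
    by (rule finite_subset[of _ "Pow (verts H)"]) (use eH finH in auto)
  have "card (edges H) \<le> (\<Sum>i\<le>2 * r. 4 * k * (5 * (k - 1)) ^ i) * card (\<psi> ` verts H)"
  proof (rule card_paths_le[where m = m and q = "\<lambda>e l. \<psi> (P e ! l)" and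
        page = "\<lambda>e l. page {\<phi> (P e ! l), \<phi> (P e ! Suc l)}", OF finE])
    show "finite (\<psi> ` verts H)" "\<psi> ` verts H \<noteq> {}" using finH ne by auto
  next
    fix e assume e: "e \<in> edges H"
    show "0 < m e \<and> m e \<le> Suc (2 * r)" using len[OF e] P[OF e] by simp
    show "inj_on (\<lambda>l. \<psi> (P e ! l)) {..m e}"
    proof (rule inj_onI)
      fix i j assume h: "i \<in> {..m e}" "j \<in> {..m e}" "\<psi> (P e ! i) = \<psi> (P e ! j)"
      then have "P e ! i = P e ! j" using inj_onD[OF \<psi> h(3)] P_S[OF e] by simp
      then show "i = j" using P[OF e] len[OF e] h by (simp add: nth_eq_iff_index_eq)
    qed
    have "P e ! 0 \<in> verts H" "P e ! m e \<in> verts H" using P_ends[OF e] eH[OF e] by auto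
    then show "\<psi> (P e ! 0) \<in> \<psi> ` verts H \<and> \<psi> (P e ! m e) \<in> \<psi> ` verts H" by simp
  next
    fix e l assume e: "e \<in> edges H" "l < m e"
    show "page {\<phi> (P e ! l), \<phi> (P e ! Suc l)} < k" using page[OF P_edge[OF e]] .
  next
    fix e l assume e: "e \<in> edges H" "0 < l" "l < m e"
    have "P e ! l \<notin> verts H" using P_inner[OF e] P[OF e(1)] by blast
    then show "\<psi> (P e ! l) \<notin> \<psi> ` verts H"
      using inj_on_image_mem_iff[OF \<psi> P_S[of e l] HS] e by simp
  next
    fix e e' l l'
    assume h: "e \<in> edges H" "e' \<in> edges H" "e \<noteq> e'" "0 < l" "l < m e" "0 < l'" "l' < m e'"
    have "P e ! l \<noteq> P e' ! l'"
      using disjoint_family_onD[OF dis h(1-3)] P_inner[OF h(1,4,5)] P_inner[OF h(2,6,7)] by auto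
    then show "\<psi> (P e ! l) \<noteq> \<psi> (P e' ! l')"
      using inj_onD[OF \<psi>] P_S[of e l] P_S[of e' l'] h by auto
  next
    fix e e' assume h: "e \<in> edges H" "e' \<in> edges H"
      "{\<psi> (P e ! 0), \<psi> (P e ! m e)} = {\<psi> (P e' ! 0), \<psi> (P e' ! m e')}"
    then have "\<psi> ` e = \<psi> ` e'" using P_ends[of e] P_ends[of e'] by (metis image_empty image_insert)
    then show "e = e'" using inj_on_image_eq_iff[OF \<psi>, of e e'] eH h HS by (meson subset_trans)
  next
    fix e e' l l' assume h: "e \<in> edges H" "e' \<in> edges H" "l < m e" "l' < m e'"
      "page {\<phi> (P e ! l), \<phi> (P e ! Suc l)} = page {\<phi> (P e' ! l'), \<phi> (P e' ! Suc l')}"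
    show "\<not> crossing (\<psi> (P e ! l)) (\<psi> (P e ! Suc l)) (\<psi> (P e' ! l')) (\<psi> (P e' ! Suc l'))"
      unfolding \<psi>_def comp_def using nc[OF P_edge P_edge] h by blast
  qed
  also have "\<dots> \<le> (\<Sum>i\<le>2 * r. 4 * k * (5 * (k - 1)) ^ i) * card (verts H)"
    by (rule mult_le_mono2[OF card_image_le[OF finH]])
  finally show ?thesis .
qed

text \<open>
  For \<open>k = 0\<close> both sides vanish, and for \<open>k \<ge> 2\<close> the sum over the number of turning points is a
  geometric one with ratio greater than 1.  For \<open>k = 1\<close> the right side would be \<open>0\<close>.
\<close>
lemma topological_grad_stack_graph:
  assumes G: "stack_graph k G" and k: "k \<noteq> 1"
  shows "topological_grad r G
           \<le> ereal (4 * real k * (5 * real k - 5) ^ (2 * r + 1) / (5 * real k - 6))"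
  unfolding topological_grad_def
proof (rule SUP_least)
  fix H assume "H \<in> {H. verts H \<noteq> {} \<and> shallow_topological_minor r H G}"
  then have ne: "verts H \<noteq> {}" and H: "shallow_topological_minor r H G" by auto
  have "finite (verts H)" using H by (simp add: shallow_topological_minor_def simple_graph_def)
  then have pos: "real (card (verts H)) > 0" using ne by (simp add: card_gt_0_iff)
  let ?x = "5 * real k - 5"
  have "real (card (edges H)) \<le> real ((\<Sum>i\<le>2 * r. 4 * k * (5 * (k - 1)) ^ i) * card (verts H))"
    using topological_minor_card_edges[OF G H ne] of_nat_mono by blast
  then have "density H \<le> real (\<Sum>i\<le>2 * r. 4 * k * (5 * (k - 1)) ^ i)"
    unfolding density_def using pos by (simp add: divide_le_eq)
  also have "\<dots> \<le> 4 * real k * ?x ^ (2 * r + 1) / (5 * real k - 6)"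
  proof (cases "k = 0")
    case False
    then have k2: "k \<ge> 2" using k by simp
    then have x: "real (5 * (k - 1)) = ?x" by (simp add: of_nat_diff)
    have x1: "?x - 1 > 0" using k2 by simp
    have "real (\<Sum>i\<le>2 * r. 4 * k * (5 * (k - 1)) ^ i) = 4 * real k * (\<Sum>i\<le>2 * r. ?x ^ i)"
      unfolding of_nat_sum of_nat_mult of_nat_power by (simp add: x[simplified] sum_distrib_left)
    also have "(\<Sum>i\<le>2 * r. ?x ^ i) = (?x ^ (2 * r + 1) - 1) / (?x - 1)"
      using geometric_sum[of ?x "2 * r + 1"] x1 by (simp add: lessThan_Suc_atMost)
    also have "4 * real k * \<dots> \<le> 4 * real k * ?x ^ (2 * r + 1) / (?x - 1)"
      using x1 by (simp add: divide_right_mono mult_left_mono)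
    finally show ?thesis by simp
  qed simp
  finally show "ereal (density H) \<le> ereal (4 * real k * ?x ^ (2 * r + 1) / (5 * real k - 6))" by simp
qed

section \<open>Breadth-first search trees in branch sets\<close>
definition adj :: "'a graph \<Rightarrow> 'a rel" where
  "adj G = {(a, b). a \<in> verts G \<and> b \<in> verts G \<and> {a, b} \<in> edges G}"

lemma path_edges_Cons2: "path_edges (a # b # p) = insert {a, b} (path_edges (b # p))"
proof
  show "path_edges (a # b # p) \<subseteq> insert {a, b} (path_edges (b # p))"
  proof
    fix e assume "e \<in> path_edges (a # b # p)"
    then obtain i where i: "e = {(a # b # p) ! i, (a # b # p) ! Suc i}" "Suc i < length (a # b # p)"
      by (auto simp: path_edges_def)
    show "e \<in> insert {a, b} (path_edges (b # p))"
    proof (cases i)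
      case (Suc j)
      then show ?thesis using i path_edges_nth[of j "b # p"] by simp
    qed (use i in simp)
  qed
  show "insert {a, b} (path_edges (b # p)) \<subseteq> path_edges (a # b # p)"
    using path_edges_nth[of 0 "a # b # p"] path_edges_nth[of "Suc _" "a # b # p"]
    by (auto simp: path_edges_def)
qed

text \<open>
  Powers of the adjacency relation turn distances and components into notions of
  \<open>relpow\<close> and \<open>rtrancl\<close>.
\<close>
lemma walk_iff_relpow:
  "(\<exists>p. walk_between G u p v \<and> length p = Suc n) \<longleftrightarrow> u \<in> verts G \<and> (u, v) \<in> adj G ^^ n"
proof (induction n arbitrary: u)
  case 0
  have "walk_between G u [u] u" if "u \<in> verts G" using that by (simp add: walk_between_def path_edges_def)
  moreover have "u = v \<and> u \<in> verts G" if "walk_between G u p v" "length p = 1" for p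
    using that by (auto simp: length_Suc_conv walk_between_def)
  ultimately show ?case by (metis One_nat_def length_Cons list.size(3) pair_in_Id_conv relpow.simps(1))
next
  case (Suc n)
  show ?case
  proof
    assume "\<exists>p. walk_between G u p v \<and> length p = Suc (Suc n)"
    then obtain w p where p: "walk_between G u (u # w # p) v" "length p = n"
      by (auto simp: length_Suc_conv walk_between_def)
    then have "walk_between G w (w # p) v" by (auto simp: walk_between_def path_edges_Cons2)
    then have "(w, v) \<in> adj G ^^ n" using Suc.IH[of w] p(2) by auto
    moreover have "(u, w) \<in> adj G" "u \<in> verts G" using p(1) by (auto simp: walk_between_def path_edges_Cons2 adj_def)
    ultimately show "u \<in> verts G \<and> (u, v) \<in> adj G ^^ Suc n" using relpow_Suc_I2 by metis
  next
    assume "u \<in> verts G \<and> (u, v) \<in> adj G ^^ Suc n"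
    then obtain w where w: "(u, w) \<in> adj G" "(w, v) \<in> adj G ^^ n" by (meson relpow_Suc_D2)
    then obtain p where p: "walk_between G w p v" "length p = Suc n" using Suc.IH[of w] by (auto simp: adj_def)
    then obtain p' where "p = w # p'" by (cases p) (auto simp: walk_between_def)
    then have "walk_between G u (u # p) v" using p w by (auto simp: walk_between_def path_edges_Cons2 adj_def)
    then show "\<exists>p. walk_between G u p v \<and> length p = Suc (Suc n)" using p(2) by auto
  qed
qed

lemma walk_iff_rtrancl: "(\<exists>p. walk_between G u p v) \<longleftrightarrow> u \<in> verts G \<and> (u, v) \<in> (adj G)\<^sup>*"
proof -
  have "(\<exists>p. walk_between G u p v) \<longleftrightarrow> (\<exists>n p. walk_between G u p v \<and> length p = Suc n)"
    by (metis Suc_pred' length_greater_0_conv walk_between_def)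
  then show ?thesis using walk_iff_relpow[of G u v] by (auto simp: rtrancl_power)
qed

lemma component_sets_eq: "component_sets G = {(adj G)\<^sup>* `` {u} |u. u \<in> verts G}"
  unfolding component_sets_def walk_iff_rtrancl by auto

lemma sym_adj: "sym (adj G)"
  by (auto simp: adj_def sym_def insert_commute)

lemma component_sets_disjoint:
  assumes "A \<in> component_sets G" "B \<in> component_sets G" "a \<in> A" "a \<in> B"
  shows "A = B"
proof -
  obtain u v where uv: "A = (adj G)\<^sup>* `` {u}" "B = (adj G)\<^sup>* `` {v}" using assms(1,2) by (auto simp: component_sets_eq)
  have sym: "(x, y) \<in> (adj G)\<^sup>* \<Longrightarrow> (y, x) \<in> (adj G)\<^sup>*" for x y by (rule symD[OF sym_rtrancl[OF sym_adj]])
  have ua: "(u, a) \<in> (adj G)\<^sup>*" and va: "(v, a) \<in> (adj G)\<^sup>*" using uv assms(3,4) by auto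
  have "(u, v) \<in> (adj G)\<^sup>*" "(v, u) \<in> (adj G)\<^sup>*"
    using rtrancl_trans[OF ua sym[OF va]] rtrancl_trans[OF va sym[OF ua]] .
  then show ?thesis unfolding uv by (auto intro: rtrancl_trans)
qed

lemma component_set_subset: "A \<in> component_sets G \<Longrightarrow> A \<subseteq> verts G"
  unfolding component_sets_eq by (auto elim: rtranclE simp: adj_def)

text \<open>
  A walk cannot leave a component, so distances in the subgraph induced by a component are
  attained.
\<close>
lemma component_connected:
  assumes A: "A \<in> component_sets G" and uv: "u \<in> A" "v \<in> A"
  shows "(u, v) \<in> (adj (induced_subgraph G A))\<^sup>*"
proof -
  obtain c where c: "A = (adj G)\<^sup>* `` {c}" using A by (auto simp: component_sets_eq)
  have "(u, c) \<in> (adj G)\<^sup>*" "(c, v) \<in> (adj G)\<^sup>*" using uv c symD[OF sym_rtrancl[OF sym_adj]] by auto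
  then have "(u, v) \<in> (adj G)\<^sup>*" by (rule rtrancl_trans)
  then show ?thesis
  proof (induction rule: rtrancl_induct)
    case (step y z)
    have "y \<in> A" using c uv(1) step(1) by (auto intro: rtrancl_trans)
    moreover have "z \<in> A" using c \<open>y \<in> A\<close> step(2) by (auto intro: rtrancl_into_rtrancl)
    ultimately have "(y, z) \<in> adj (induced_subgraph G A)"
      using step(2) by (auto simp: adj_def induced_subgraph_def)
    then show ?case using step.IH by (rule rtrancl_into_rtrancl[rotated])
  qed simp
qed

lemma graph_dist_adj:
  assumes "(u, v) \<in> (adj G)\<^sup>*" "u \<in> verts G"
  shows "(u, v) \<in> adj G ^^ graph_dist G u v"
proof -
  have eq: "graph_dist G u v = (LEAST n. (u, v) \<in> adj G ^^ n)"
    unfolding graph_dist_def walk_iff_relpow using assms(2) by simp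
  show ?thesis unfolding eq using rtrancl_imp_relpow[OF assms(1)] by (rule LeastI_ex)
qed

lemma graph_dist_le: "u \<in> verts G \<Longrightarrow> (u, v) \<in> adj G ^^ n \<Longrightarrow> graph_dist G u v \<le> n"
  unfolding graph_dist_def walk_iff_relpow by (rule Least_le) simp

text \<open>
  A vertex realising the radius is taken as the root, \<open>dep\<close> is the distance to it and \<open>par\<close> steps to
  a neighbour closer to it.  A vertex outside \<open>X\<close> is its own root.
\<close>
lemma branch_set_tree:
  assumes X: "subgraph X G" and rad: "\<forall>C\<in>components X. radius C \<le> d"
    and A: "A \<in> verts (contract G X)"
  shows "\<exists>r dep par. r \<in> A \<and> (\<forall>v\<in>A. dep v \<le> d \<and> (dep v = 0 \<longrightarrow> v = r) \<and>
           (\<forall>n. dep v = Suc n \<longrightarrow> par v \<in> A \<and> dep (par v) = n \<and> {par v, v} \<in> edges G))"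
proof (cases "A \<in> component_sets X")
  case False
  then obtain v where "A = {v}" using A by (auto simp: contract_def Let_def)
  then show ?thesis by (intro exI[of _ v] exI[of _ "\<lambda>_. 0"]) auto
next
  case True
  let ?C = "induced_subgraph X A"
  have AX: "A \<subseteq> verts X" using component_set_subset[OF True] .
  have vC: "verts ?C = A" using AX by (auto simp: induced_subgraph_def)
  have ne: "A \<noteq> {}" using True by (auto simp: component_sets_eq)
  have finA: "finite A" using AX X by (auto simp: subgraph_def simple_graph_def intro: finite_subset)
  have "radius ?C \<le> d" using rad True by (auto simp: components_def)
  moreover have "radius ?C \<in> (\<lambda>r. MAX v\<in>A. graph_dist ?C r v) ` A"
    unfolding radius_def vC using finA ne by (intro Min_in) auto
  ultimately obtain r where r: "r \<in> A" "(MAX v\<in>A. graph_dist ?C r v) \<le> d" by auto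
  let ?dep = "graph_dist ?C r"
  have dep_d: "?dep v \<le> d" if "v \<in> A" for v
    using r(2) finA that by (meson Max_ge finite_imageI image_eqI le_trans)
  have walk: "(r, v) \<in> adj ?C ^^ ?dep v" if "v \<in> A" for v
    using graph_dist_adj[OF component_connected[OF True r(1) that]] r(1) vC by simp
  have par: "\<exists>w. w \<in> A \<and> ?dep w = n \<and> {w, v} \<in> edges G" if v: "v \<in> A" "?dep v = Suc n" for v n
  proof -
    obtain w where w: "(r, w) \<in> adj ?C ^^ n" "(w, v) \<in> adj ?C" using walk[OF v(1)] v(2) by auto
    have wA: "w \<in> A" and e: "{w, v} \<in> edges G"
      using w(2) vC X by (auto simp: adj_def induced_subgraph_def subgraph_def)
    have "?dep w \<le> n" using graph_dist_le[OF _ w(1)] r(1) vC by simp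
    moreover have "(r, v) \<in> adj ?C ^^ Suc (?dep w)" using walk[OF wA] w(2) by auto
    then have "?dep v \<le> Suc (?dep w)" using graph_dist_le r(1) vC by metis
    ultimately show ?thesis using wA e v(2) by auto
  qed
  define par' where "par' v = (SOME w. w \<in> A \<and> Suc (?dep w) = ?dep v \<and> {w, v} \<in> edges G)" for v
  have par': "par' v \<in> A \<and> ?dep (par' v) = n \<and> {par' v, v} \<in> edges G" if v: "v \<in> A" "?dep v = Suc n" for v n
  proof -
    have "\<exists>w. w \<in> A \<and> Suc (?dep w) = ?dep v \<and> {w, v} \<in> edges G" using par[OF v] v(2) by auto
    then have "par' v \<in> A \<and> Suc (?dep (par' v)) = ?dep v \<and> {par' v, v} \<in> edges G"
      unfolding par'_def by (rule someI_ex)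
    then show ?thesis using v(2) by simp
  qed
  have root: "v = r" if "v \<in> A" "?dep v = 0" for v using walk[OF that(1)] that(2) by simp
  show ?thesis using r(1) dep_d par' root by (intro exI[of _ r] exI[of _ ?dep] exI[of _ par']) blast
qed

lemma contract_verts_disjoint:
  assumes "A \<in> verts (contract G X)" "B \<in> verts (contract G X)" "a \<in> A" "a \<in> B"
  shows "A = B"
  using assms component_sets_disjoint[of A X B a] component_set_subset[of A X] component_set_subset[of B X]
  by (auto simp: contract_def Let_def)

lemma contract_verts_subset:
  assumes "subgraph X G" "A \<in> verts (contract G X)"
  shows "A \<subseteq> verts G"
  using assms component_set_subset[of A X] by (auto simp: contract_def Let_def subgraph_def)

section \<open>Shallow minors of stack graphs\<close>
definition page_lists :: "nat \<Rightarrow> nat \<Rightarrow> nat list set" where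
  "page_lists k d = {w. set w \<subseteq> {..<k} \<and> length w \<le> d}"

text \<open>
  An edge of a shallow minor has a type, consisting of the page sequences of the two tree paths and the page of the
  edge between the two branch sets.  The first factor counts the types, and the second one is the bound of
  \<open>card_linked_le\<close> with both lengths increased to \<open>d\<close>.
\<close>
definition minor_bound :: "nat \<Rightarrow> nat \<Rightarrow> nat" where
  "minor_bound k d = card (page_lists k d \<times> {..<k} \<times> page_lists k d) * (5 * (4 ^ d + 4 ^ d) * 2 ^ (d + d))"

text \<open>
  Ordered pairs of adjacent branch sets are sorted by their type.  A vertex lies in one branch set
  only and its parent depends on that branch set only; hence tree paths of different
  instances that share a point share everything from there to the root, as
  \<open>card_linked_le\<close> requires.
\<close>
lemma shallow_minor_card_edges:
  assumes G: "stack_graph k G" and H: "shallow_minor d H G" and ne: "verts H \<noteq> {}"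
  shows "card (edges H) \<le> minor_bound k d * card (verts H)"
proof -
  obtain pos page where pos: "inj_on pos (verts G)" and page: "\<And>e. e \<in> edges G \<Longrightarrow> page e < k"
    and nc: "\<And>a b c d. {a, b} \<in> edges G \<Longrightarrow> {c, d} \<in> edges G \<Longrightarrow> page {a, b} = page {c, d} \<Longrightarrow>
       \<not> crossing (pos a) (pos b) (pos c) (pos d)"
    using stack_graph_positions[OF G] by metis
  obtain X where X: "subgraph X G" and rad: "\<forall>C\<in>components X. radius C \<le> d"
    and HX: "subgraph H (contract G X)"
    using H by (auto simp: shallow_minor_def)
  let ?W = "verts (contract G X)"
  have "\<forall>A\<in>?W. \<exists>T. fst T \<in> A \<and> (\<forall>v\<in>A. fst (snd T) v \<le> d \<and> (fst (snd T) v = 0 \<longrightarrow> v = fst T) \<and>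
       (\<forall>n. fst (snd T) v = Suc n \<longrightarrow> snd (snd T) v \<in> A \<and> fst (snd T) (snd (snd T) v) = n \<and>
          {snd (snd T) v, v} \<in> edges G))"
    using branch_set_tree[OF X rad] by simp
  then obtain T where T: "\<And>A. A \<in> ?W \<Longrightarrow> fst (T A) \<in> A \<and>
      (\<forall>v\<in>A. fst (snd (T A)) v \<le> d \<and> (fst (snd (T A)) v = 0 \<longrightarrow> v = fst (T A)) \<and>
       (\<forall>n. fst (snd (T A)) v = Suc n \<longrightarrow> snd (snd (T A)) v \<in> A \<and>
          fst (snd (T A)) (snd (snd (T A)) v) = n \<and> {snd (snd (T A)) v, v} \<in> edges G))"
    by metis
  define root where "root A = fst (T A)" for A
  define dep where "dep A = fst (snd (T A))" for A
  define par where "par A = snd (snd (T A))" for A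
  have root: "root A \<in> A" if "A \<in> ?W" for A using T[OF that] by (simp add: root_def)
  have dep_d: "dep A v \<le> d" and dep0: "dep A v = 0 \<Longrightarrow> v = root A" and
    par: "dep A v = Suc n \<Longrightarrow> par A v \<in> A \<and> dep A (par A v) = n \<and> {par A v, v} \<in> edges G"
    if "A \<in> ?W" "v \<in> A" for A v n
    using T[OF that(1)] that(2) by (auto simp: root_def dep_def par_def)
  \<comment> \<open>\<open>anc A v j\<close> is the ancestor of \<open>v\<close> at depth \<open>j\<close>, so that \<open>j\<close> counts from the root as in the iteration.\<close>
  define anc where "anc A v j = (par A ^^ (dep A v - j)) v" for A v j
  have up: "(par A ^^ i) v \<in> A \<and> dep A ((par A ^^ i) v) = dep A v - i"
    if "A \<in> ?W" "v \<in> A" "i \<le> dep A v" for A v i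
    using that(3)
  proof (induction i)
    case (Suc i)
    then have IH: "(par A ^^ i) v \<in> A" "dep A ((par A ^^ i) v) = Suc (dep A v - Suc i)" by auto
    then show ?case using par[OF that(1) IH] by simp
  qed (use that in simp)
  have anc: "anc A v j \<in> A \<and> dep A (anc A v j) = j" if "A \<in> ?W" "v \<in> A" "j \<le> dep A v" for A v j
    using up[OF that(1,2), of "dep A v - j"] that(3) by (simp add: anc_def)
  have anc_top: "anc A v (dep A v) = v" for A v by (simp add: anc_def)
  have anc_par: "anc A v j = par A (anc A v (Suc j))" if "j < dep A v" for A v j
  proof -
    have "dep A v - j = Suc (dep A v - Suc j)" using that by simp
    then show ?thesis by (simp add: anc_def)
  qed
  have anc_edge: "{anc A v j, anc A v (Suc j)} \<in> edges G" if "A \<in> ?W" "v \<in> A" "j < dep A v" for A v j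
    using par[OF that(1), of "anc A v (Suc j)" j] anc[OF that(1,2), of "Suc j"] that(3) anc_par[OF that(3)] by simp
  have anc0: "anc A v 0 = root A" if "A \<in> ?W" "v \<in> A" for A v
    using anc[OF that, of 0] dep0[OF that(1)] by simp
  have WG: "A \<subseteq> verts G" if "A \<in> ?W" for A using contract_verts_subset[OF X that] .
  have WH: "verts H \<subseteq> ?W" using HX by (simp add: subgraph_def)
  have pos_branch: "A = B \<and> a = b" if "A \<in> ?W" "B \<in> ?W" "a \<in> A" "b \<in> B" "pos a = pos b" for A B a b
  proof -
    have "a = b" using inj_onD[OF pos that(5)] WG that by blast
    then show ?thesis using contract_verts_disjoint that by metis
  qed
  define D where "D = {(A, B). {A, B} \<in> edges H}"
  have eH: "A \<in> verts H \<and> B \<in> verts H \<and> (\<exists>a\<in>A. \<exists>b\<in>B. {a, b} \<in> edges G)" if "(A, B) \<in> D" for A B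
  proof -
    have "{A, B} \<in> edges H" using that by (simp add: D_def)
    then have "{A, B} \<subseteq> verts H" "{A, B} \<in> edges (contract G X)"
      using HX by (auto simp: subgraph_def simple_graph_def)
    then show ?thesis
      by (auto simp: contract_def Let_def doubleton_eq_iff) (metis insert_commute)+
  qed
  then obtain a b where ab: "\<And>A B. (A, B) \<in> D \<Longrightarrow> a A B \<in> A \<and> b A B \<in> B \<and> {a A B, b A B} \<in> edges G"
    by metis
  have DW: "A \<in> ?W" "B \<in> ?W" if "(A, B) \<in> D" for A B using eH[OF that] WH by auto
  have finH: "finite (verts H)" using HX by (simp add: subgraph_def simple_graph_def)
  have finD: "finite D" by (rule finite_subset[of _ "verts H \<times> verts H"]) (use eH finH in auto)
  define word where "word A v = map (\<lambda>j. page {anc A v j, anc A v (Suc j)}) [0..<dep A v]" for A v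
  have word: "word A v \<in> page_lists k d" if "A \<in> ?W" "v \<in> A" for A v
    using page[OF anc_edge[OF that]] dep_d[OF that] by (auto simp: word_def page_lists_def)
  define type where "type = (\<lambda>(A, B). (word A (a A B), page {a A B, b A B}, word B (b A B)))"
  let ?\<Omega> = "page_lists k d \<times> {..<k} \<times> page_lists k d"
  have fin\<Omega>: "finite ?\<Omega>"
    using finite_lists_length_le[of "{..<k}" d] by (simp add: page_lists_def)
  define V where "V = (\<lambda>A. pos (root A)) ` verts H"
  have V: "finite V" "V \<noteq> {}" using finH ne by (auto simp: V_def)
  have cardV: "card V \<le> card (verts H)" unfolding V_def by (rule card_image_le[OF finH])
  have fib: "card {e \<in> D. type e = \<omega>} \<le> 5 * (4 ^ d + 4 ^ d) * 2 ^ (d + d) * card (verts H)" if "\<omega> \<in> ?\<Omega>" for \<omega>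
  proof -
    obtain \<tau> p \<sigma> where \<omega>: "\<omega> = (\<tau>, p, \<sigma>)" by (cases \<omega>) auto
    have ls: "length \<tau> \<le> d" "length \<sigma> \<le> d" using that by (auto simp: \<omega> page_lists_def)
    let ?F = "{e \<in> D. type e = \<omega>}"
    define x where "x j = (\<lambda>(A, B). pos (anc A (a A B) j))" for j
    define y where "y j = (\<lambda>(A, B). pos (anc B (b A B) j))" for j
    have ty: "(A, B) \<in> D" "A \<in> ?W" "B \<in> ?W" "a A B \<in> A" "b A B \<in> B" "{a A B, b A B} \<in> edges G"
      "word A (a A B) = \<tau>" "word B (b A B) = \<sigma>" "page {a A B, b A B} = p"
      "dep A (a A B) = length \<tau>" "dep B (b A B) = length \<sigma>" if "(A, B) \<in> ?F" for A B
      using that DW[of A B] ab[of A B] by (auto simp: type_def \<omega> word_def)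
    have wn: "page {anc A v j, anc A v (Suc j)} = word A v ! j" if "j < dep A v" for A v j
      using that by (simp add: word_def)
    have "card ?F \<le> 5 * ((4 ^ length \<tau> + 4 ^ length \<sigma> - 1) * card V) * 2 ^ (length \<tau> + length \<sigma>)"
    proof (rule card_linked_le[OF _ V, where x = x and y = y])
      show "finite ?F" using finD by simp
      show "x 0 e \<in> V" if "e \<in> ?F" for e
      proof -
        obtain A B where e: "e = (A, B)" by (cases e)
        show ?thesis using ty(1-5)[of A B] eH[of A B] anc0 that by (auto simp: e x_def V_def)
      qed
      show "y 0 e \<in> V" if "e \<in> ?F" for e
      proof -
        obtain A B where e: "e = (A, B)" by (cases e)
        show ?thesis using ty(1-5)[of A B] eH[of A B] anc0 that by (auto simp: e y_def V_def)
      qed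
      show "inj_on (\<lambda>e. (x 0 e, y 0 e)) ?F"
      proof (rule inj_onI)
        fix e e' assume h: "e \<in> ?F" "e' \<in> ?F" "(x 0 e, y 0 e) = (x 0 e', y 0 e')"
        obtain A B A' B' where e: "e = (A, B)" "e' = (A', B')" by (cases e, cases e')
        note t = ty[OF h(1)[unfolded e]] and t' = ty[OF h(2)[unfolded e]]
        have "pos (root A) = pos (root A')" "pos (root B) = pos (root B')"
          using h(3) anc0 t t' by (simp_all add: e x_def y_def)
        then show "e = e'" using pos_branch root t t' unfolding e by blast
      qed
    next
      fix j e e' assume h: "j < length \<tau>" "e \<in> ?F" "e' \<in> ?F"
      obtain A B A' B' where e: "e = (A, B)" "e' = (A', B')" by (cases e, cases e')
      note t = ty[OF h(2)[unfolded e]] and t' = ty[OF h(3)[unfolded e]]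
      show "x j e = x j e'" if "x (Suc j) e = x (Suc j) e'"
      proof -
        have "A = A' \<and> anc A (a A B) (Suc j) = anc A' (a A' B') (Suc j)"
          using that t t' h(1) anc by (intro pos_branch) (auto simp: e x_def)
        moreover have "j < dep A (a A B)" "j < dep A' (a A' B')" using t t' h(1) by simp_all
        ultimately have "anc A (a A B) j = anc A' (a A' B') j" using anc_par by metis
        then show ?thesis by (simp add: e x_def)
      qed
      show "\<not> crossing (x j e) (x (Suc j) e) (x j e') (x (Suc j) e')"
        using nc[OF anc_edge anc_edge, of A "a A B" j A' "a A' B'" j] wn t t' h(1) by (simp add: e x_def)
    next
      fix j e e' assume h: "j < length \<sigma>" "e \<in> ?F" "e' \<in> ?F"
      obtain A B A' B' where e: "e = (A, B)" "e' = (A', B')" by (cases e, cases e')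
      note t = ty[OF h(2)[unfolded e]] and t' = ty[OF h(3)[unfolded e]]
      show "y j e = y j e'" if "y (Suc j) e = y (Suc j) e'"
      proof -
        have "B = B' \<and> anc B (b A B) (Suc j) = anc B' (b A' B') (Suc j)"
          using that t t' h(1) anc by (intro pos_branch) (auto simp: e y_def)
        moreover have "j < dep B (b A B)" "j < dep B' (b A' B')" using t t' h(1) by simp_all
        ultimately have "anc B (b A B) j = anc B' (b A' B') j" using anc_par by metis
        then show ?thesis by (simp add: e y_def)
      qed
      show "\<not> crossing (y j e) (y (Suc j) e) (y j e') (y (Suc j) e')"
        using nc[OF anc_edge anc_edge, of B "b A B" j B' "b A' B'" j] wn t t' h(1) by (simp add: e y_def)
    next
      fix e e' assume h: "e \<in> ?F" "e' \<in> ?F"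
      obtain A B A' B' where e: "e = (A, B)" "e' = (A', B')" by (cases e, cases e')
      note t = ty[OF h(1)[unfolded e]] and t' = ty[OF h(2)[unfolded e]]
      have "anc A (a A B) (length \<tau>) = a A B" "anc B (b A B) (length \<sigma>) = b A B"
        "anc A' (a A' B') (length \<tau>) = a A' B'" "anc B' (b A' B') (length \<sigma>) = b A' B'"
        using anc_top[of A "a A B"] anc_top[of B "b A B"] anc_top[of A' "a A' B'"] anc_top[of B' "b A' B'"] t t'
        by simp_all
      then show "\<not> crossing (x (length \<tau>) e) (y (length \<sigma>) e) (x (length \<tau>) e') (y (length \<sigma>) e')"
        using nc[OF t(6) t'(6)] t(9) t'(9) by (simp add: e x_def y_def)
    qed
    also have "\<dots> \<le> 5 * ((4 ^ d + 4 ^ d) * card (verts H)) * 2 ^ (d + d)"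
    proof -
      have "(4::nat) ^ length \<tau> \<le> 4 ^ d" "(4::nat) ^ length \<sigma> \<le> 4 ^ d" using ls by (auto intro: power_increasing)
      then have "(4::nat) ^ length \<tau> + 4 ^ length \<sigma> - 1 \<le> 4 ^ d + 4 ^ d" by linarith
      then have "5 * ((4 ^ length \<tau> + 4 ^ length \<sigma> - 1) * card V) \<le> 5 * ((4 ^ d + 4 ^ d) * card (verts H))"
        by (intro mult_le_mono2 mult_le_mono cardV)
      moreover have "(2::nat) ^ (length \<tau> + length \<sigma>) \<le> 2 ^ (d + d)" using ls by (auto intro: power_increasing)
      ultimately show ?thesis by (rule mult_le_mono)
    qed
    finally show ?thesis by (simp add: mult_ac)
  qed
  have "edges H \<subseteq> (\<lambda>(A, B). {A, B}) ` D"
  proof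
    fix e assume e: "e \<in> edges H"
    then have "card e = 2" using HX by (auto simp: subgraph_def simple_graph_def)
    then obtain A B where "e = {A, B}" by (meson card_2_iff)
    then show "e \<in> (\<lambda>(A, B). {A, B}) ` D" using e by (force simp: D_def)
  qed
  then have "card (edges H) \<le> card ((\<lambda>(A, B). {A, B}) ` D)" using finD by (intro card_mono) auto
  also have "\<dots> \<le> card D" by (rule card_image_le[OF finD])
  also have "\<dots> \<le> card (\<Union>\<omega>\<in>?\<Omega>. {e \<in> D. type e = \<omega>})"
  proof (rule card_mono)
    show "finite (\<Union>\<omega>\<in>?\<Omega>. {e \<in> D. type e = \<omega>})" using fin\<Omega> finD by auto
    show "D \<subseteq> (\<Union>\<omega>\<in>?\<Omega>. {e \<in> D. type e = \<omega>})"
    proof clarify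
      fix A B assume h: "(A, B) \<in> D"
      have "type (A, B) \<in> ?\<Omega>" using word DW[OF h] ab[OF h] page by (simp add: type_def)
      then show "(A, B) \<in> (\<Union>\<omega>\<in>?\<Omega>. {e \<in> D. type e = \<omega>})" using h by blast
    qed
  qed
  also have "\<dots> \<le> (\<Sum>\<omega>\<in>?\<Omega>. card {e \<in> D. type e = \<omega>})" by (rule card_UN_le[OF fin\<Omega>])
  also have "\<dots> \<le> (\<Sum>\<omega>\<in>?\<Omega>. 5 * (4 ^ d + 4 ^ d) * 2 ^ (d + d) * card (verts H))" by (rule sum_mono) (rule fib)
  also have "\<dots> = minor_bound k d * card (verts H)" by (simp add: minor_bound_def)
  finally show ?thesis .
qed


lemma bounded_expansion_stack_graphs: "bounded_expansion {G :: 'a graph. stack_graph k G}"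
  unfolding bounded_expansion_def
proof (intro exI allI)
  fix d
  show "grad d {G :: 'a graph. stack_graph k G} \<le> ereal (real (minor_bound k d))"
    unfolding grad_def
  proof (rule SUP_least)
    fix H :: "'a set graph"
    assume "H \<in> {H. verts H \<noteq> {} \<and> (\<exists>G\<in>{G. stack_graph k G}. shallow_minor d H G)}"
    then obtain G where ne: "verts H \<noteq> {}" and G: "stack_graph k G" and H: "shallow_minor d H G" by auto
    have "finite (verts H)" using H by (auto simp: shallow_minor_def subgraph_def simple_graph_def)
    then have pos: "real (card (verts H)) > 0" using ne by (simp add: card_gt_0_iff)
    have "real (card (edges H)) \<le> real (minor_bound k d * card (verts H))"
      using shallow_minor_card_edges[OF G H ne] of_nat_mono by blast
    then show "ereal (density H) \<le> ereal (real (minor_bound k d))"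
      unfolding density_def using pos by (simp add: divide_le_eq)
  qed
qed

theorem theorem8p4:
  fixes k :: nat
  shows "bounded_expansion {G :: 'a graph. stack_graph k G} \<and>
    (k \<noteq> 1 \<longrightarrow>
      (\<forall>(G :: 'a graph) (r :: nat). stack_graph k G \<longrightarrow>
        topological_grad r G
          \<le> ereal (4 * real k * (5 * real k - 5) ^ (2 * r + 1) / (5 * real k - 6))))"
  using bounded_expansion_stack_graphs topological_grad_stack_graph by blast

end
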